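(* Let $\lambda,\Lambda,\kappa,C_0>0$ and let $u\in C(\overline{B}_1)$ satisfy, in the viscosity sense, $$\mathcal{L}^-_\kappa(D^2u,Du)\le C_0\quad\text{and}\quad \mathcal{L}^+_\kappa(D^2u,Du)\ge -C_0\qquad\text{in } B_1,$$ together with $\|u\|_{L^\infty(B_1)}\le C_0$. Then $u\in C^\alpha(B_{1/2})$ and $$\|u\|_{C^\alpha(B_{1/2})}\le C\,C_0,$$ where the exponent $\alpha\in(0,1)$ depends only on $\lambda,\Lambda,n$ and the constant $C$ depends only on $\kappa/C_0,\lambda,\Lambda,n$.
   Context: $B_r\subset\mathbb{R}^n$ is the open ball of radius $r$ centred at the origin. For a real symmetric $n\times n$ matrix $X$, $X^+$ and $X^-$ denote its positive and negative parts ($X=X^+-X^-$, $X^\pm\ge0$, $X^+X^-=0$), so $\operatorname{Tr}X^+$ is the sum of the positive eigenvalues and $\operatorname{Tr}X^-$ is minus the sum of the negative eigenvalues; $|X|$ is the maximum of the absolute values of the eigenvalues of $X$. For positive constants $\lambda,\Lambda,\kappa$ and $p\in\mathbb{R}^n$ define $$\mathcal{L}^+_\kappa(X,p)=\begin{cases}\Lambda\operatorname{Tr}X^+-\lambda\operatorname{Tr}X^-+\Lambda|p| & |X|>\kappa,\\ +\infty & |X|\le\kappa,\end{cases}\qquad \mathcal{L}^-_\kappa(X,p)=\begin{cases}\lambda\operatorname{Tr}X^+-\Lambda\operatorname{Tr}X^--\Lambda|p| & |X|>\kappa,\\ -\infty & |X|\le\kappa.\end{cases}$$ A lower semicontinuous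 function $u$ satisfies $\mathcal{L}^-_\kappa(D^2u,Du)\le c$ in an open set $\Omega$ in the viscosity sense if, whenever $x_0\in\Omega$ and $\varphi$ is $C^2$ near $x_0$ with $\varphi(x_0)=u(x_0)$ and $\varphi\le u$ near $x_0$, one has $\mathcal{L}^-_\kappa(D^2\varphi(x_0),D\varphi(x_0))\le c$. An upper semicontinuous function $u$ satisfies $\mathcal{L}^+_\kappa(D^2u,Du)\ge c$ in $\Omega$ in the viscosity sense if, whenever $x_0\in\Omega$ and $\varphi$ is $C^2$ near $x_0$ with $\varphi(x_0)=u(x_0)$ and $\varphi\ge u$ near $x_0$, one has $\mathcal{L}^+_\kappa(D^2\varphi(x_0),D\varphi(x_0))\ge c$. *)

theory Defs
  imports "HOL-Analysis.Analysis" "HOL-Probability.Essential_Supremum"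
begin

section \<open>Symmetric matrices\<close>

definition psd :: "real^'n^'n \<Rightarrow> bool" where
  "psd X \<longleftrightarrow> transpose X = X \<and> (\<forall>v. 0 \<le> v \<bullet> (X *v v))"

definition pos_neg_decomp :: "real^'n^'n \<Rightarrow> real^'n^'n \<Rightarrow> real^'n^'n \<Rightarrow> bool" where
  "pos_neg_decomp X P N \<longleftrightarrow> X = P - N \<and> psd P \<and> psd N \<and> P ** N = 0"

text \<open>The decomposition exists and is unique for symmetric \<open>X\<close>; for other \<open>X\<close> the values of the
  following two functions are unspecified and irrelevant.\<close>

definition pos_part :: "real^'n^'n \<Rightarrow> real^'n^'n" where
  "pos_part X = (THE P. \<exists>N. pos_neg_decomp X P N)"

definition neg_part :: "real^'n^'n \<Rightarrow> real^'n^'n" where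
  "neg_part X = (THE N. \<exists>P. pos_neg_decomp X P N)"

definition eigenvalues :: "real^'n^'n \<Rightarrow> real set" where
  "eigenvalues X = {\<mu>. \<exists>v. v \<noteq> 0 \<and> X *v v = \<mu> *\<^sub>R v}"

text \<open>The library norm on \<open>real^'n^'n\<close> is the Frobenius norm, hence a separate definition.\<close>

definition eig_norm :: "real^'n^'n \<Rightarrow> real" where
  "eig_norm X = Max (abs ` eigenvalues X)"

section \<open>The extremal operators\<close>

definition L_plus :: "real \<Rightarrow> real \<Rightarrow> real \<Rightarrow> real^'n^'n \<Rightarrow> real^'n \<Rightarrow> ereal" where
  "L_plus lam Lam kappa X p =
     (if eig_norm X > kappa
      then ereal (Lam * trace (pos_part X) - lam * trace (neg_part X) + Lam * norm p)
      else \<infinity>)"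

definition L_minus :: "real \<Rightarrow> real \<Rightarrow> real \<Rightarrow> real^'n^'n \<Rightarrow> real^'n \<Rightarrow> ereal" where
  "L_minus lam Lam kappa X p =
     (if eig_norm X > kappa
      then ereal (lam * trace (pos_part X) - Lam * trace (neg_part X) - Lam * norm p)
      else - \<infinity>)"

section \<open>Test functions and viscosity inequalities\<close>

definition grad :: "(real^'n \<Rightarrow> real) \<Rightarrow> real^'n \<Rightarrow> real^'n" where
  "grad f x = (\<chi> i. frechet_derivative f (at x) (axis i 1))"

definition hess :: "(real^'n \<Rightarrow> real) \<Rightarrow> real^'n \<Rightarrow> real^'n^'n" where
  "hess f x = jacobian (grad f) (at x)"

definition C2_near :: "real^'n \<Rightarrow> (real^'n \<Rightarrow> real) \<Rightarrow> bool" where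
  "C2_near x0 f \<longleftrightarrow> (\<exists>U. open U \<and> x0 \<in> U \<and>
     (\<forall>x\<in>U. f differentiable (at x)) \<and>
     (\<forall>x\<in>U. grad f differentiable (at x)) \<and>
     continuous_on U (hess f))"

definition lsc_on :: "(real^'n) set \<Rightarrow> (real^'n \<Rightarrow> real) \<Rightarrow> bool" where
  "lsc_on S u \<longleftrightarrow> (\<forall>x\<in>S. \<forall>a < u x. eventually (\<lambda>y. a < u y) (at x within S))"

definition usc_on :: "(real^'n) set \<Rightarrow> (real^'n \<Rightarrow> real) \<Rightarrow> bool" where
  "usc_on S u \<longleftrightarrow> (\<forall>x\<in>S. \<forall>a > u x. eventually (\<lambda>y. u y < a) (at x within S))"

definition viscosity_le ::
  "(real^'n^'n \<Rightarrow> real^'n \<Rightarrow> ereal) \<Rightarrow> (real^'n) set \<Rightarrow> real \<Rightarrow> (real^'n \<Rightarrow> real) \<Rightarrow> bool" where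
  "viscosity_le F \<Omega> c u \<longleftrightarrow> lsc_on \<Omega> u \<and>
     (\<forall>x0\<in>\<Omega>. \<forall>\<phi>. C2_near x0 \<phi> \<longrightarrow> \<phi> x0 = u x0 \<longrightarrow>
        eventually (\<lambda>x. \<phi> x \<le> u x) (nhds x0) \<longrightarrow>
        F (hess \<phi> x0) (grad \<phi> x0) \<le> ereal c)"

definition viscosity_ge ::
  "(real^'n^'n \<Rightarrow> real^'n \<Rightarrow> ereal) \<Rightarrow> (real^'n) set \<Rightarrow> real \<Rightarrow> (real^'n \<Rightarrow> real) \<Rightarrow> bool" where
  "viscosity_ge F \<Omega> c u \<longleftrightarrow> usc_on \<Omega> u \<and>
     (\<forall>x0\<in>\<Omega>. \<forall>\<phi>. C2_near x0 \<phi> \<longrightarrow> \<phi> x0 = u x0 \<longrightarrow>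
        eventually (\<lambda>x. \<phi> x \<ge> u x) (nhds x0) \<longrightarrow>
        F (hess \<phi> x0) (grad \<phi> x0) \<ge> ereal c)"

section \<open>Function space norms\<close>

definition Linf_norm :: "(real^'n) set \<Rightarrow> (real^'n \<Rightarrow> real) \<Rightarrow> ennreal" where
  "Linf_norm S u = esssup (restrict_space lborel S) (\<lambda>x. ennreal \<bar>u x\<bar>)"

definition holder_seminorm :: "real \<Rightarrow> (real^'n) set \<Rightarrow> (real^'n \<Rightarrow> real) \<Rightarrow> ennreal" where
  "holder_seminorm \<alpha> S u =
     (SUP (x, y) \<in> {(x, y). x \<in> S \<and> y \<in> S \<and> x \<noteq> y}. ennreal (\<bar>u x - u y\<bar> / norm (x - y) powr \<alpha>))"

definition holder_norm :: "real \<Rightarrow> (real^'n) set \<Rightarrow> (real^'n \<Rightarrow> real) \<Rightarrow> ennreal" where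
  "holder_norm \<alpha> S u = (SUP x\<in>S. ennreal \<bar>u x\<bar>) + holder_seminorm \<alpha> S u"

definition holder_space :: "real \<Rightarrow> (real^'n) set \<Rightarrow> (real^'n \<Rightarrow> real) set" where
  "holder_space \<alpha> S = {u. holder_norm \<alpha> S u < \<infinity>}"

end

theory Submission
  imports Defs
begin

text \<open>A viscosity inequality for \<open>L_minus\<close> tested with quadratic polynomials whose Hessian is
  \<open>s e e\<^sup>T - t I\<close> yields \<open>s \<le> N (t + |p|) + c\<close>: if the Hessian is at most \<open>\<kappa>\<close>, then \<open>s - t \<le> \<kappa>\<close>, so the
  threshold is absorbed in the constant \<open>c\<close>. These tests suffice for a
  Krylov-Safonov argument: a Gaussian barrier propagates smallness to smaller balls; sliding paraboloids
  from below, the map from contact points to vertices is Lipschitz because a kink between two touching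
  paraboloids would admit a forbidden convex test function, so \<open>u\<close> is small on a set of positive
  density; a Vitali covering argument upgrades this to a small superlevel set, which gives oscillation
  decay when applied to \<open>u\<close> and \<open>- u\<close>.\<close>


section \<open>Quadratic test functions\<close>

text \<open>The form of the class is dictated by scaling: passing to a ball of radius r \<le> 1 and
  dividing values by m keeps \<open>N\<close> and replaces \<open>c\<close> by
  \<open>c * r\<^sup>2 / m\<close>, whereas the original operators would change their threshold each
  time. The price is that information comes only from test functions strongly convex in one
  direction \<open>e\<close>, so both contradictions below, at the barrier and at the kink, have to
  manufacture such a function. Two obstacles remain. The solution is merely continuous, so the map
  from contact points to vertices cannot be differentiated; its Lipschitz bound is proved at small
  finite distances and combined with a covering. Moreover the density obtained may be far below 1/2,
  too little to compare the sets where \<open>u\<close> and its reflection are small; hence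
  superlevel sets must first be made to decay over shrinking balls. For the dependence of constants,
  \<open>N\<close> never sees \<open>kappa\<close>, and C0 / lam + kappa is a multiple of C0 once
  kappa / C0 is fixed.\<close>

definition pucci_super :: "real \<Rightarrow> real \<Rightarrow> 'a::euclidean_space set \<Rightarrow> ('a \<Rightarrow> real) \<Rightarrow> bool" where
  "pucci_super N c \<Omega> u \<longleftrightarrow> (\<forall>x0\<in>\<Omega>. \<forall>p e s t. norm e = 1 \<longrightarrow> 0 < s \<longrightarrow> 0 < t \<longrightarrow>
     (\<forall>\<^sub>F x in nhds x0. u x0 + p \<bullet> (x - x0) + s / 2 * (e \<bullet> (x - x0))\<^sup>2 - t / 2 * (norm (x - x0))\<^sup>2 \<le> u x) \<longrightarrow>
     s \<le> N * (t + norm p) + c)"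

section \<open>The matrices a e e^T + b I, with eigenvalue a + b along a unit vector e and b
  orthogonally to it\<close>

definition outer :: "real \<Rightarrow> real \<Rightarrow> real^'n \<Rightarrow> real^'n^'n" where
  "outer a b e = (\<chi> i j. a * (e $ i * e $ j) + (if i = j then b else 0))"

lemma outer_vec: "outer a b e *v h = (a * (e \<bullet> h)) *\<^sub>R e + b *\<^sub>R h"
proof -
  have "(\<Sum>j\<in>UNIV. (a * (e $ i * e $ j) + (if i = j then b else 0)) * h $ j)
    = a * (e \<bullet> h) * e $ i + b * h $ i" for i
  proof -
    have "(\<Sum>j\<in>UNIV. (a * (e $ i * e $ j) + (if i = j then b else 0)) * h $ j)
       = (\<Sum>j\<in>UNIV. a * e $ i * (e $ j * h $ j) + (if i = j then b * h $ j else 0))"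
      by (intro sum.cong) (auto simp: algebra_simps)
    also have "\<dots> = a * e $ i * (\<Sum>j\<in>UNIV. e $ j * h $ j) + b * h $ i"
      by (simp add: sum.distrib sum_distrib_left)
    finally show ?thesis by (simp add: inner_vec_def mult_ac)
  qed
  then show ?thesis
    by (simp add: vec_eq_iff matrix_vector_mult_def outer_def)
qed

lemma transpose_outer: "transpose (outer a b e) = outer a b e"
  by (auto simp: transpose_def outer_def vec_eq_iff mult_ac)

lemma trace_outer: "trace (outer a b (e::real^'n)) = a * (norm e)\<^sup>2 + b * CARD('n)"
  by (simp add: trace_def outer_def sum.distrib power2_norm_eq_inner inner_vec_def sum_distrib_left)

lemma minus_outer: "- outer a b e = outer (- a) (- b) e"
  by (simp add: outer_def vec_eq_iff)

lemma matrix_eqI: "(\<And>v. A *v v = B *v v) \<Longrightarrow> A = (B :: real^'n^'m)"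
  by (simp add: matrix_eq)

text \<open>For symmetric P and N, transposing \<open>P ** N = 0\<close> gives
  \<open>N ** P = 0\<close>, so negating the matrix only exchanges the two parts. This transfers the
  computations for \<open>L_minus\<close> to \<open>L_plus\<close>.\<close>

lemma pos_neg_decomp_commute: "pos_neg_decomp (- X) P N \<longleftrightarrow> pos_neg_decomp X N P"
proof -
  have "P ** N = 0 \<longleftrightarrow> N ** P = 0" if "psd P" "psd N" for P N :: "real^'n^'n"
  proof -
    have "transpose (P ** N) = N ** P"
      using that by (simp add: matrix_transpose_mul psd_def)
    moreover have "transpose (N ** P) = P ** N"
      using that by (simp add: matrix_transpose_mul psd_def)
    moreover have "transpose (0 :: real^'n^'n) = 0"
      by (simp add: transpose_def vec_eq_iff)
    ultimately show ?thesis by metis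
  qed
  moreover have "- X = P - N \<longleftrightarrow> X = N - P"
    by (metis minus_diff_eq minus_minus)
  ultimately show ?thesis
    unfolding pos_neg_decomp_def by blast
qed

lemma pos_part_uminus: "pos_part (- X) = neg_part X"
  and neg_part_uminus: "neg_part (- X) = pos_part X"
  by (simp_all add: pos_part_def neg_part_def pos_neg_decomp_commute)

text \<open>Since P N = N P = 0, applying P to P v - N v = m v gives P P v = m P v, hence |P v|^2 =
  m (v . P v), which forces P v = 0 when m \<le> 0; in the same way N v = 0 when m > 0. The parts
  are thus determined on every eigenvector, which yields uniqueness below without a spectral
  theorem.\<close>

lemma pos_neg_decomp_eigenvector:
  assumes d: "pos_neg_decomp X P N" and v: "X *v v = m *\<^sub>R v"
  shows "P *v v = max m 0 *\<^sub>R v"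
proof -
  have PN: "P ** N = 0" and psd: "psd P" "psd N" and X: "X = P - N"
    using d by (auto simp: pos_neg_decomp_def)
  have NP: "N ** P = 0"
    using d pos_neg_decomp_commute[of X N P] by (simp add: pos_neg_decomp_def)
  have sym: "(A *v x) \<bullet> y = x \<bullet> (A *v y)" if "psd A" for A :: "real^'n^'n" and x y
    using that dot_lmul_matrix[of x A y] transpose_matrix_vector[of A x]
    by (metis psd_def)
  have e: "P *v v - N *v v = m *\<^sub>R v"
    using v X by (simp add: matrix_vector_mult_diff_rdistrib)
  have P2: "P *v (P *v v) = m *\<^sub>R (P *v v)"
  proof -
    have "P *v (P *v v - N *v v) = P *v (m *\<^sub>R v)" using e by simp
    then show ?thesis
      by (simp add: matrix_vector_mult_diff_distrib matrix_vector_mul_assoc PN matrix_vector_mult_scaleR)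
  qed
  have N2: "N *v (N *v v) = - m *\<^sub>R (N *v v)"
  proof -
    have "N *v (P *v v - N *v v) = N *v (m *\<^sub>R v)" using e by simp
    then show ?thesis
      by (simp add: matrix_vector_mult_diff_distrib matrix_vector_mul_assoc NP matrix_vector_mult_scaleR)
         (metis add.inverse_inverse)
  qed
  show ?thesis
  proof (cases "m \<le> 0")
    case True
    have "(P *v v) \<bullet> (P *v v) = v \<bullet> (P *v (P *v v))" using sym psd by blast
    also have "\<dots> = m * (v \<bullet> (P *v v))" by (simp add: P2)
    also have "\<dots> \<le> 0" using True psd by (simp add: psd_def mult_nonpos_nonneg)
    finally have "P *v v = 0" by (metis inner_eq_zero_iff inner_ge_zero order_antisym)
    then show ?thesis using True by simp
  next
    case False
    have "(N *v v) \<bullet> (N *v v) = v \<bullet> (N *v (N *v v))" using sym psd by blast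
    also have "\<dots> = - m * (v \<bullet> (N *v v))" by (simp add: N2)
    also have "\<dots> \<le> 0" using False psd by (simp add: psd_def mult_nonneg_nonneg)
    finally have "N *v v = 0" by (metis inner_eq_zero_iff inner_ge_zero order_antisym)
    then show ?thesis using False e by simp
  qed
qed

lemma psd_outer:
  assumes "norm e = 1" "0 \<le> b" "0 \<le> a + b"
  shows "psd (outer a b e)"
  unfolding psd_def
proof (intro conjI allI transpose_outer)
  fix v
  have "(e \<bullet> v)\<^sup>2 \<le> (norm v)\<^sup>2"
    using Cauchy_Schwarz_ineq[of e v] assms by (simp add: power2_norm_eq_inner norm_eq_1)
  then have "0 \<le> b * ((norm v)\<^sup>2 - (e \<bullet> v)\<^sup>2)" "0 \<le> (a + b) * (e \<bullet> v)\<^sup>2"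
    using assms by auto
  moreover have "v \<bullet> (outer a b e *v v) = b * ((norm v)\<^sup>2 - (e \<bullet> v)\<^sup>2) + (a + b) * (e \<bullet> v)\<^sup>2"
    unfolding power2_norm_eq_inner
    by (simp add: outer_vec inner_add_right inner_commute power2_eq_square algebra_simps)
  ultimately show "0 \<le> v \<bullet> (outer a b e *v v)"
    by simp
qed

text \<open>\<open>outer (s - t) 0 e\<close> is s - t times the orthogonal projection onto the line
  of \<open>e\<close>, and \<open>outer (- t) t e\<close> is t times the complementary projection,
  so their product vanishes.\<close>

lemma pos_neg_decomp_outer:
  assumes "norm e = 1" "0 < t" "t < s"
  shows "pos_neg_decomp (outer s (- t) e) (outer (s - t) 0 e) (outer (- t) t e)"
proof -
  have "e \<bullet> e = 1" using assms by (simp add: norm_eq_1)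
  then have "outer (s - t) 0 e ** outer (- t) t e = 0"
    by (intro matrix_eqI) (simp add: outer_vec matrix_vector_mul_assoc[symmetric] inner_add_right inner_diff_right algebra_simps)
  moreover have "outer s (- t) e = outer (s - t) 0 e - outer (- t) t e"
    by (simp add: outer_def vec_eq_iff algebra_simps)
  ultimately show ?thesis
    using assms by (simp add: pos_neg_decomp_def psd_outer)
qed

text \<open>The definite descriptions require uniqueness: any decomposition agrees with the explicit
  one on \<open>e\<close> and on its orthogonal complement, because both consist of eigenvectors,
  and together they span the space.\<close>

lemma pos_part_outer:
  assumes "norm e = 1" "0 < t" "t < s"
  shows "pos_part (outer s (- t) e) = outer (s - t) 0 e"
    and "neg_part (outer s (- t) e) = outer (- t) t e"
proof -
  note d = pos_neg_decomp_outer[OF assms]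
  have ee: "e \<bullet> e = 1" using assms by (simp add: norm_eq_1)
  have uniq: "P = outer (s - t) 0 e" if d': "pos_neg_decomp (outer s (- t) e) P N" for P N
  proof (rule matrix_eqI)
    fix v
    define w where "w = v - (e \<bullet> v) *\<^sub>R e"
    have v: "v = (e \<bullet> v) *\<^sub>R e + w" by (simp add: w_def)
    have "e \<bullet> w = 0" by (simp add: w_def inner_diff_right ee)
    then have 1: "outer s (- t) e *v w = (- t) *\<^sub>R w" by (simp add: outer_vec)
    have 2: "outer s (- t) e *v e = (s - t) *\<^sub>R e" by (simp add: outer_vec ee algebra_simps)
    have "P *v w = outer (s - t) 0 e *v w" "P *v e = outer (s - t) 0 e *v e"
      using pos_neg_decomp_eigenvector[OF d' 1] pos_neg_decomp_eigenvector[OF d' 2]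
        pos_neg_decomp_eigenvector[OF d 1] pos_neg_decomp_eigenvector[OF d 2] by simp_all
    then show "P *v v = outer (s - t) 0 e *v v"
      by (subst (1 2) v) (simp only: matrix_vector_right_distrib matrix_vector_mult_scaleR)
  qed
  have uniq': "N = outer (- t) t e" if d': "pos_neg_decomp (outer s (- t) e) P N" for P N
  proof -
    have "outer s (- t) e = P - N" "outer s (- t) e = outer (s - t) 0 e - outer (- t) t e"
      using d d' by (simp_all add: pos_neg_decomp_def)
    then show ?thesis using uniq[OF d'] by (metis diff_eq_diff_eq diff_left_imp_eq)
  qed
  show "pos_part (outer s (- t) e) = outer (s - t) 0 e"
    unfolding pos_part_def by (rule the_equality) (use d uniq in blast)+
  show "neg_part (outer s (- t) e) = outer (- t) t e"
    unfolding neg_part_def by (rule the_equality) (use d uniq' in blast)+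
qed

text \<open>\<open>eig_norm\<close> is a \<open>Max\<close>, so finiteness of the spectrum has to be
  shown. An inclusion is all that can be claimed, as \<open>b\<close> need not be an eigenvalue in
  dimension one.\<close>

lemma abs_le_eig_norm_outer:
  assumes "norm e = 1"
  shows "\<bar>a + b\<bar> \<le> eig_norm (outer a b e)"
proof -
  have ee: "e \<bullet> e = 1" "e \<noteq> 0" using assms by (auto simp: norm_eq_1)
  have "eigenvalues (outer a b e) \<subseteq> {a + b, b}"
  proof
    fix m assume "m \<in> eigenvalues (outer a b e)"
    then obtain v where v: "v \<noteq> 0" "(a * (e \<bullet> v)) *\<^sub>R e + b *\<^sub>R v = m *\<^sub>R v"
      by (auto simp: eigenvalues_def outer_vec)
    show "m \<in> {a + b, b}"
    proof (cases "e \<bullet> v = 0")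
      case True
      then show ?thesis using v by simp
    next
      case False
      have "e \<bullet> ((a * (e \<bullet> v)) *\<^sub>R e + b *\<^sub>R v) = m * (e \<bullet> v)" using v(2) by simp
      then have "(a + b) * (e \<bullet> v) = m * (e \<bullet> v)" by (simp add: inner_add_right ee algebra_simps)
      then show ?thesis using False by simp
    qed
  qed
  then have fin: "finite (eigenvalues (outer a b e))" by (rule finite_subset) simp
  have "a + b \<in> eigenvalues (outer a b e)"
    unfolding eigenvalues_def using ee
    by (intro CollectI exI[of _ e]) (simp add: outer_vec algebra_simps)
  then show ?thesis
    unfolding eig_norm_def using fin by (intro Max_ge) auto
qed

section \<open>From viscosity inequalities to tests by quadratic polynomials\<close>

lemma quadratic_test:
  fixes x0 p e :: "real^'n" and k s t :: real
  defines "\<phi> \<equiv> \<lambda>x. k + p \<bullet> (x - x0) + s / 2 * (e \<bullet> (x - x0))\<^sup>2 - t / 2 * (norm (x - x0))\<^sup>2"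
  shows "C2_near x0 \<phi>" "grad \<phi> x0 = p" "hess \<phi> x0 = outer s (- t) e"
proof -
  define g where "g = (\<lambda>x. p + (s * (e \<bullet> (x - x0))) *\<^sub>R e - t *\<^sub>R (x - x0))"
  have d: "(\<phi> has_derivative (\<lambda>h. g x \<bullet> h)) (at x)" for x
    unfolding \<phi>_def g_def power2_norm_eq_inner
    by (auto intro!: derivative_eq_intros simp: inner_add_left inner_diff_left inner_commute algebra_simps fun_eq_iff power2_eq_square)
  have gr: "grad \<phi> = g"
  proof
    fix x
    have "frechet_derivative \<phi> (at x) = (\<lambda>h. g x \<bullet> h)"
      using frechet_derivative_at[OF d] by simp
    then show "grad \<phi> x = g x"
      by (simp add: grad_def vec_eq_iff inner_axis)
  qed
  have d2: "(g has_derivative (\<lambda>h. outer s (- t) e *v h)) (at x)" for x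
    unfolding g_def outer_vec
    by (auto intro!: derivative_eq_intros simp: algebra_simps)
  have hs: "hess \<phi> x = outer s (- t) e" for x
    unfolding hess_def gr jacobian_def frechet_derivative_at[OF d2, symmetric] by simp
  show "grad \<phi> x0 = p" by (simp add: gr g_def)
  show "hess \<phi> x0 = outer s (- t) e" by (rule hs)
  show "C2_near x0 \<phi>"
    unfolding C2_near_def gr
    using d d2 by (intro exI[of _ UNIV]) (auto simp: differentiable_def hs[abs_def] fun_eq_iff hs)
qed

text \<open>Here \<open>m\<close> stands for the dimension, \<open>q\<close> for the gradient norm,
  and t (m - 1) for the trace of the negative part of the test Hessian. If the eigenvalue s - t
  along \<open>e\<close> exceeds \<open>kappa\<close>, the operator inequality is available and is
  divided by \<open>lam\<close>; otherwise s \<le> t + kappa suffices, whatever the other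
  eigenvalues are.\<close>

lemma extremal_threshold_bound:
  fixes lam Lam kappa C0 s t q m :: real
  assumes "0 < lam" "0 < Lam" "0 < kappa" "0 < C0" "0 < s" "0 < t" "0 \<le> q" "1 \<le> m"
    and "t < s \<Longrightarrow> kappa < s - t \<Longrightarrow> lam * (s - t) - Lam * (t * (m - 1)) - Lam * q \<le> C0"
  shows "s \<le> (1 + Lam * m / lam) * (t + q) + (C0 / lam + kappa)"
proof (cases "kappa < s - t")
  case True
  have "Lam * q \<le> Lam * (m * q)" "0 \<le> Lam * t"
    using assms mult_right_mono[of 1 m q] by (auto intro!: mult_left_mono)
  note q = this
  have "lam * (s - t) \<le> C0 + Lam * (t * (m - 1)) + Lam * q" using assms True by linarith
  also have "\<dots> \<le> C0 + Lam * m * t + Lam * m * q"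
    using q by (simp add: algebra_simps)
  finally have "s - t \<le> (C0 + Lam * m * t + Lam * m * q) / lam"
    using assms by (simp add: field_simps)
  also have "\<dots> = C0 / lam + Lam * m / lam * (t + q)" by (simp add: add_divide_distrib algebra_simps)
  finally have "s \<le> t + (C0 / lam + Lam * m / lam * (t + q))" by simp
  then show ?thesis using assms by (simp add: algebra_simps)
next
  case False
  have "0 \<le> Lam * m / lam * (t + q)" "0 \<le> C0 / lam" using assms by auto
  moreover have "(1 + Lam * m / lam) * (t + q) = t + q + Lam * m / lam * (t + q)" by (simp add: algebra_simps)
  ultimately show ?thesis using False assms by linarith
qed

lemma viscosity_le_pucci_super:
  fixes u :: "real^'n \<Rightarrow> real"
  assumes pos: "0 < lam" "0 < Lam" "0 < kappa" "0 < C0"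
    and v: "viscosity_le (L_minus lam Lam kappa) \<Omega> C0 u"
  shows "pucci_super (1 + Lam * CARD('n) / lam) (C0 / lam + kappa) \<Omega> u"
  unfolding pucci_super_def
proof (intro ballI allI impI)
  fix x0 p e :: "real^'n" and s t :: real
  assume x0: "x0 \<in> \<Omega>" and e: "norm e = 1" and st: "0 < s" "0 < t"
    and ev: "\<forall>\<^sub>F x in nhds x0. u x0 + p \<bullet> (x - x0) + s / 2 * (e \<bullet> (x - x0))\<^sup>2 - t / 2 * (norm (x - x0))\<^sup>2 \<le> u x"
  note q = quadratic_test[where ?x0.0 = x0 and k = "u x0" and p = p and s = s and e = e and t = t]
  have L: "L_minus lam Lam kappa (outer s (- t) e) p \<le> ereal C0"
    using v x0 ev q unfolding viscosity_le_def by fastforce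
  show "s \<le> (1 + Lam * CARD('n) / lam) * (t + norm p) + (C0 / lam + kappa)"
  proof (rule extremal_threshold_bound[OF pos st])
    assume a: "t < s" "kappa < s - t"
    then have "kappa < eig_norm (outer s (- t) e)"
      using abs_le_eig_norm_outer[OF e, of s "- t"] by linarith
    then show "lam * (s - t) - Lam * (t * (real CARD('n) - 1)) - Lam * norm p \<le> C0"
      using L e by (simp add: L_minus_def pos_part_outer[OF e st(2) a(1)] trace_outer algebra_simps)
  qed (auto simp: Suc_le_eq)
qed

text \<open>Negation exchanges touching from below and from above and swaps positive and negative
  parts, so \<open>L_plus\<close> at the negated Hessian and gradient is minus
  \<open>L_minus\<close> at the original ones. The test polynomial is therefore used with
  \<open>p\<close>, \<open>s\<close> and \<open>t\<close> all negated.\<close>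

lemma viscosity_ge_pucci_super:
  fixes u :: "real^'n \<Rightarrow> real"
  assumes pos: "0 < lam" "0 < Lam" "0 < kappa" "0 < C0"
    and v: "viscosity_ge (L_plus lam Lam kappa) \<Omega> (- C0) u"
  shows "pucci_super (1 + Lam * CARD('n) / lam) (C0 / lam + kappa) \<Omega> (\<lambda>x. - u x)"
  unfolding pucci_super_def
proof (intro ballI allI impI)
  fix x0 p e :: "real^'n" and s t :: real
  assume x0: "x0 \<in> \<Omega>" and e: "norm e = 1" and st: "0 < s" "0 < t"
    and ev: "\<forall>\<^sub>F x in nhds x0. - u x0 + p \<bullet> (x - x0) + s / 2 * (e \<bullet> (x - x0))\<^sup>2 - t / 2 * (norm (x - x0))\<^sup>2 \<le> - u x"
  note q = quadratic_test[where ?x0.0 = x0 and k = "u x0" and p = "- p" and s = "- s" and e = e and t = "- t"]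
  have ev': "\<forall>\<^sub>F x in nhds x0. u x \<le> u x0 + (- p) \<bullet> (x - x0) + (- s) / 2 * (e \<bullet> (x - x0))\<^sup>2 - (- t) / 2 * (norm (x - x0))\<^sup>2"
    using ev by eventually_elim simp
  have "L_plus lam Lam kappa (outer (- s) (- (- t)) e) (- p) \<ge> ereal (- C0)"
    using v x0 ev' q unfolding viscosity_ge_def by fastforce
  then have L: "L_plus lam Lam kappa (- outer s (- t) e) (- p) \<ge> ereal (- C0)"
    by (simp add: minus_outer)
  show "s \<le> (1 + Lam * CARD('n) / lam) * (t + norm p) + (C0 / lam + kappa)"
  proof (rule extremal_threshold_bound[OF pos st])
    assume a: "t < s" "kappa < s - t"
    then have "kappa < eig_norm (- outer s (- t) e)"
      using abs_le_eig_norm_outer[OF e, of "- s" "- (- t)"] by (simp add: minus_outer)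
    then show "lam * (s - t) - Lam * (t * (real CARD('n) - 1)) - Lam * norm p \<le> C0"
      using L e by (simp add: L_plus_def pos_part_uminus neg_part_uminus pos_part_outer[OF e st(2) a(1)] trace_outer algebra_simps)
  qed (auto simp: Suc_le_eq)
qed

section \<open>Scaling and the barrier\<close>

lemma pucci_superD:
  assumes "pucci_super N c \<Omega> u" "x0 \<in> \<Omega>" "norm e = 1" "0 < s" "0 < t"
    and "\<forall>\<^sub>F x in nhds x0. u x0 + p \<bullet> (x - x0) + s / 2 * (e \<bullet> (x - x0))\<^sup>2 - t / 2 * (norm (x - x0))\<^sup>2 \<le> u x"
  shows "s \<le> N * (t + norm p) + c"
  using assms unfolding pucci_super_def by blast

text \<open>A test polynomial for the rescaled function is one for \<open>u\<close> with gradient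
  multiplied by m / r and curvatures by m / r^2. Scaling back leaves N (t + r |p|) + c r^2 / m, and
  r \<le> 1 removes the factor of |p|: the gradient term is of lower order.\<close>

lemma pucci_super_scale:
  fixes u :: "'a::euclidean_space \<Rightarrow> real"
  assumes "pucci_super N c \<Omega> u" "0 < r" "r \<le> 1" "0 < m" "0 \<le> N"
    and sub: "\<And>x. x \<in> \<Omega>' \<Longrightarrow> z + r *\<^sub>R x \<in> \<Omega>"
  shows "pucci_super N (c * r\<^sup>2 / m) \<Omega>' (\<lambda>x. (u (z + r *\<^sub>R x) - k) / m)"
  unfolding pucci_super_def
proof (intro ballI allI impI)
  fix x0 p e :: 'a and s t :: real
  assume x0: "x0 \<in> \<Omega>'" and e: "norm e = 1" and st: "0 < s" "0 < t"
    and ev: "\<forall>\<^sub>F x in nhds x0. (u (z + r *\<^sub>R x0) - k) / m + p \<bullet> (x - x0) + s / 2 * (e \<bullet> (x - x0))\<^sup>2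
      - t / 2 * (norm (x - x0))\<^sup>2 \<le> (u (z + r *\<^sub>R x) - k) / m"
  define y0 where "y0 = z + r *\<^sub>R x0"
  define f where "f = (\<lambda>y. (1 / r) *\<^sub>R (y - z))"
  have "(f \<longlongrightarrow> f y0) (nhds y0)"
    unfolding f_def by (intro tendsto_intros filterlim_ident)
  moreover have fy0: "f y0 = x0" using assms by (simp add: f_def y0_def)
  ultimately have "filterlim f (nhds x0) (nhds y0)" by simp
  from eventually_compose_filterlim[OF ev this]
  have "\<forall>\<^sub>F y in nhds y0. u y0 + ((m / r) *\<^sub>R p) \<bullet> (y - y0) + (m * s / r\<^sup>2) / 2 * (e \<bullet> (y - y0))\<^sup>2
      - (m * t / r\<^sup>2) / 2 * (norm (y - y0))\<^sup>2 \<le> u y"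
  proof eventually_elim
    case (elim y)
    have 1: "z + r *\<^sub>R f y = y" using assms by (simp add: f_def)
    have 2: "f y - x0 = (1 / r) *\<^sub>R (y - y0)"
      unfolding fy0[symmetric] by (simp add: f_def algebra_simps)
    have 3: "p \<bullet> (f y - x0) = (p \<bullet> (y - y0)) / r" "e \<bullet> (f y - x0) = (e \<bullet> (y - y0)) / r"
      "norm (f y - x0) = norm (y - y0) / r"
      unfolding 2 using assms by simp_all
    have "m * ((u y0 - k) / m + (p \<bullet> (y - y0)) / r + s / 2 * ((e \<bullet> (y - y0)) / r)\<^sup>2
      - t / 2 * (norm (y - y0) / r)\<^sup>2) \<le> m * ((u y - k) / m)"
      using elim assms unfolding 1 3 y0_def[symmetric] by (intro mult_left_mono) auto
    moreover have "m * ((u y - k) / m) = u y - k" using assms by simp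
    moreover have "m * ((u y0 - k) / m + (p \<bullet> (y - y0)) / r + s / 2 * ((e \<bullet> (y - y0)) / r)\<^sup>2
      - t / 2 * (norm (y - y0) / r)\<^sup>2) = u y0 - k + ((m / r) *\<^sub>R p) \<bullet> (y - y0) + (m * s / r\<^sup>2) / 2 * (e \<bullet> (y - y0))\<^sup>2
      - (m * t / r\<^sup>2) / 2 * (norm (y - y0))\<^sup>2"
    proof -
      have "m * ((u y0 - k) / m) = u y0 - k" using assms by simp
      then show ?thesis by (simp add: distrib_left right_diff_distrib power_divide mult_ac)
    qed
    ultimately show ?case by simp
  qed
  moreover have "y0 \<in> \<Omega>" using sub x0 by (simp add: y0_def)
  moreover have "0 < m * s / r\<^sup>2" "0 < m * t / r\<^sup>2" using assms st by auto
  ultimately have "m * s / r\<^sup>2 \<le> N * (m * t / r\<^sup>2 + norm ((m / r) *\<^sub>R p)) + c"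
    using pucci_superD[OF assms(1) _ e] by blast
  then have "m * s / r\<^sup>2 * (r\<^sup>2 / m) \<le> (N * (m * t / r\<^sup>2 + m / r * norm p) + c) * (r\<^sup>2 / m)"
    using assms by (intro mult_right_mono) auto
  moreover have "m * s / r\<^sup>2 * (r\<^sup>2 / m) = s" using assms by simp
  moreover have "(N * (m * t / r\<^sup>2 + m / r * norm p) + c) * (r\<^sup>2 / m) = N * (t + r * norm p) + c * r\<^sup>2 / m"
    using assms by (simp add: field_simps power2_eq_square)
  ultimately have "s \<le> N * (t + r * norm p) + c * r\<^sup>2 / m" by simp
  also have "N * (t + r * norm p) \<le> N * (t + 1 * norm p)"
    using assms by (intro mult_left_mono add_left_mono mult_right_mono) auto
  finally show "s \<le> N * (t + norm p) + c * r\<^sup>2 / m" by simp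
qed

section \<open>Gaussian barrier\<close>

lemma exp_lower_quadratic:
  assumes "- 2 \<le> (y::real)"
  shows "1 + y + y\<^sup>2 / 4 \<le> exp y"
proof -
  \<comment> \<open>Squaring the tangent line bound at y / 2 needs a nonnegative base, hence the
    restriction on y.\<close>
  have "(1 + y / 2)\<^sup>2 \<le> (exp (y / 2))\<^sup>2"
    using assms exp_ge_add_one_self[of "y / 2"] by (intro power_mono) auto
  then show ?thesis
    by (simp add: power2_eq_square field_simps flip: exp_add)
qed

text \<open>In the barrier argument \<open>a\<close> is the inner product of x0 and x - x0, and
  \<open>b\<close> is |x - x0|^2, so the exponent is -g (|x|^2 - |x0|^2). Half of the square of
  \<open>a\<close> absorbs the cross term, and smallness of \<open>g * b\<close> absorbs the rest,
  leaving convexity in the radial direction only.\<close>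

lemma gaussian_lower_quadratic:
  fixes a b g :: real
  assumes "0 < g" "0 \<le> b" "g * b \<le> 4" "g * (2 * a + b) \<le> 2"
  shows "1 - 2 * g * a - 2 * g * b + g\<^sup>2 / 2 * a\<^sup>2 \<le> exp (- g * (2 * a + b))"
proof -
  have "g * b * (g * b) \<le> 4 * (g * b)" using assms by (intro mult_right_mono) auto
  moreover have "0 \<le> (g * (a + b))\<^sup>2" by simp
  moreover have "1 - g * (2 * a + b) + (g * (2 * a + b))\<^sup>2 / 4 \<le> exp (- g * (2 * a + b))"
    using exp_lower_quadratic[of "- g * (2 * a + b)"] assms by simp
  ultimately show ?thesis
    by (simp add: power2_eq_square algebra_simps add_divide_distrib)
qed

text \<open>Comparison with a truncated Gaussian, a strict subsolution away from the origin.\<close>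

lemma pucci_super_doubling:
  fixes u :: "'a::euclidean_space \<Rightarrow> real"
  assumes N: "1 \<le> N" and sup: "pucci_super N 1 (ball 0 4) u"
    and cont: "continuous_on (ball 0 4) u" and nn: "\<And>x. x \<in> ball 0 4 \<Longrightarrow> 0 \<le> u x"
    and y: "y \<in> cball 0 2" "u y \<le> 1"
  shows "\<exists>x\<in>cball 0 (1/8). u x \<le> 2 * exp (9 * (64 * (10 * N + 1)))"
proof (rule ccontr)
  \<comment> \<open>Large enough for the final contradiction: outside the ball of radius 1/8 the
    radial convexity E g^2 |x0|^2 is at least E g (10 N + 1), against the remaining E (10 N g +
    1).\<close>
  define g where "g = 64 * (10 * N + 1)"
  \<comment> \<open>This height makes the Gaussian at least 2 on the ball of radius 3 and \<Gamma>
    larger than 1 on the ball of radius 2.\<close>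
  define A where "A = 2 * exp (9 * g)"
  assume "\<not> ?thesis"
  then have big: "A < u x" if "norm x \<le> 1/8" for x
    using that by (force simp: A_def g_def)
  have g: "1 \<le> g" using N by (simp add: g_def)
  \<comment> \<open>\<Gamma> vanishes at radius 3 and is at most A < u at radius 1/8, so a negative
    minimum of u - \<Gamma> over the annulus between these radii is interior.\<close>
  define \<Gamma> where "\<Gamma> x = A * (exp (- g * (norm x)\<^sup>2) - exp (- g * 9))" for x :: 'a
  define K where "K = {x::'a. 1/8 \<le> norm x} \<inter> cball 0 3"
  have Ksub: "K \<subseteq> ball 0 4" by (auto simp: K_def)
  have "closed {x::'a. 1/8 \<le> norm x}" by (intro closed_Collect_le continuous_intros)
  then have compK: "compact K"
    unfolding K_def using closed_Int_compact compact_cball by blast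
  have Gy: "1 < \<Gamma> y"
  proof -
    have "(norm y)\<^sup>2 \<le> 2\<^sup>2" using y by (intro power_mono) auto
    then have "exp (- g * 4) \<le> exp (- g * (norm y)\<^sup>2)" using g by simp
    then have "A * (exp (- g * 4) - exp (- g * 9)) \<le> \<Gamma> y"
      unfolding \<Gamma>_def by (intro mult_left_mono) (auto simp: A_def)
    moreover have "A * (exp (- g * 4) - exp (- g * 9)) = 2 * (exp (5 * g) - 1)"
      by (simp add: A_def right_diff_distrib mult.assoc flip: exp_add)
    ultimately have "2 * (exp (5 * g) - 1) \<le> \<Gamma> y" by argo
    moreover have "6 \<le> exp (5 * g)" by (rule order.trans[OF _ exp_ge_add_one_self[of "5 * g"]]) (use g in simp)
    ultimately show ?thesis by argo
  qed
  have yK: "y \<in> K"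
  proof -
    have "1 \<le> exp (9 * g)" using g by simp
    then have "1 \<le> A" unfolding A_def by linarith
    then have "\<not> norm y \<le> 1/8" using big[of y] y by linarith
    then show ?thesis using y by (auto simp: K_def)
  qed
  have "continuous_on K (\<lambda>x. u x - \<Gamma> x)"
    unfolding \<Gamma>_def by (intro continuous_intros continuous_on_subset[OF cont Ksub])
  then obtain x0 where x0: "x0 \<in> K" and min: "\<And>x. x \<in> K \<Longrightarrow> u x0 - \<Gamma> x0 \<le> u x - \<Gamma> x"
    using continuous_attains_inf[OF compK] yK by blast
  have neg: "u x0 < \<Gamma> x0" using min[OF yK] Gy y by simp
  have "norm x0 \<noteq> 1/8"
  proof
    assume "norm x0 = 1/8"
    then have "A < u x0" using big by simp
    moreover have "\<Gamma> x0 \<le> A * (1 - 0)"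
      unfolding \<Gamma>_def using g by (intro mult_left_mono diff_mono) (auto simp: A_def)
    ultimately show False using neg by simp
  qed
  moreover have "norm x0 \<noteq> 3"
  proof
    assume "norm x0 = 3"
    then have "\<Gamma> x0 = 0" by (simp add: \<Gamma>_def)
    moreover have "0 \<le> u x0" using nn x0 Ksub by blast
    ultimately show False using neg by simp
  qed
  ultimately have in0: "1/8 < norm x0" "norm x0 < 3" using x0 by (auto simp: K_def)
  define E where "E = A * exp (- g * (norm x0)\<^sup>2)"
  have E: "1 \<le> E"
  proof -
    have "(norm x0)\<^sup>2 \<le> 3\<^sup>2" using in0 by (intro power_mono) auto
    then have "exp (- g * 9) \<le> exp (- g * (norm x0)\<^sup>2)" using g by simp
    then have "A * exp (- g * 9) \<le> E" unfolding E_def by (intro mult_left_mono) (auto simp: A_def)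
    moreover have "A * exp (- g * 9) = 2" by (simp add: A_def mult.assoc flip: exp_add)
    ultimately show ?thesis by simp
  qed
  define e where "e = x0 /\<^sub>R norm x0"
  have "x0 \<noteq> 0" using in0 by auto
  then have e: "norm e = 1" "x0 = norm x0 *\<^sub>R e" by (auto simp: e_def)
  define W where "W = {x. g * (2 * (x0 \<bullet> (x - x0)) + (norm (x - x0))\<^sup>2) < 2 \<and> g * (norm (x - x0))\<^sup>2 < 4
    \<and> 1/8 < norm x \<and> norm x < 3}"
  have "open W"
    unfolding W_def by (intro open_Collect_conj open_Collect_less continuous_intros)
  moreover have "x0 \<in> W" using in0 by (simp add: W_def)
  ultimately have "\<forall>\<^sub>F x in nhds x0. x \<in> W" by (rule eventually_nhds_in_open)
  \<comment> \<open>The coefficients are those of \<open>gaussian_lower_quadratic\<close> multiplied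
    by \<open>E\<close>, with x0 written as |x0| times the radial unit vector
    \<open>e\<close>.\<close>
  then have "\<forall>\<^sub>F x in nhds x0. u x0 + (- (2 * g * E) *\<^sub>R x0) \<bullet> (x - x0)
     + (E * g\<^sup>2 * (norm x0)\<^sup>2) / 2 * (e \<bullet> (x - x0))\<^sup>2 - (4 * g * E) / 2 * (norm (x - x0))\<^sup>2 \<le> u x"
  proof eventually_elim
    case (elim x)
    note elim = elim[unfolded W_def mem_Collect_eq]
    let ?a = "x0 \<bullet> (x - x0)" and ?b = "(norm (x - x0))\<^sup>2"
    have "x \<in> K" using elim by (auto simp: K_def)
    then have 1: "u x0 + (\<Gamma> x - \<Gamma> x0) \<le> u x" using min by fastforce
    have "(norm x)\<^sup>2 = (norm x0)\<^sup>2 + (2 * ?a + ?b)"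
      by (simp add: power2_norm_eq_inner inner_diff_left inner_diff_right inner_commute)
    then have "exp (- g * (norm x)\<^sup>2) = exp (- g * (norm x0)\<^sup>2) * exp (- g * (2 * ?a + ?b))"
      by (simp only: exp_add[symmetric] distrib_left)
    then have "\<Gamma> x - \<Gamma> x0 = E * (exp (- g * (2 * ?a + ?b)) - 1)"
      unfolding \<Gamma>_def E_def by (simp only:) (simp add: right_diff_distrib)
    moreover have "1 - 2 * g * ?a - 2 * g * ?b + g\<^sup>2 / 2 * ?a\<^sup>2 \<le> exp (- g * (2 * ?a + ?b))"
      using elim g by (intro gaussian_lower_quadratic) auto
    then have "E * (1 - 2 * g * ?a - 2 * g * ?b + g\<^sup>2 / 2 * ?a\<^sup>2 - 1) \<le> E * (exp (- g * (2 * ?a + ?b)) - 1)"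
      using E by (intro mult_left_mono) auto
    moreover have "?a\<^sup>2 = (norm x0)\<^sup>2 * (e \<bullet> (x - x0))\<^sup>2"
      by (subst e(2)) (simp add: power_mult_distrib)
    ultimately show ?case using 1
      by (simp add: algebra_simps)
  qed
  moreover have "x0 \<in> ball 0 4" using x0 Ksub by blast
  moreover have "0 < E * g\<^sup>2 * (norm x0)\<^sup>2" "0 < 4 * g * E"
    using E g \<open>x0 \<noteq> 0\<close> by auto
  ultimately have "E * g\<^sup>2 * (norm x0)\<^sup>2 \<le> N * (4 * g * E + norm (- (2 * g * E) *\<^sub>R x0)) + 1"
    using pucci_superD[OF sup _ e(1)] by blast
  also have "norm (- (2 * g * E) *\<^sub>R x0) \<le> 2 * g * E * 3"
    using g E in0 by (auto simp: mult.assoc intro!: mult_left_mono)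
  then have "N * (4 * g * E + norm (- (2 * g * E) *\<^sub>R x0)) + 1 \<le> N * (4 * g * E + 2 * g * E * 3) + E"
    using N E g by (intro add_mono mult_left_mono) auto
  also have "\<dots> = E * (g * (10 * N) + 1)" by (simp add: algebra_simps)
  also have "\<dots> < E * (g * (10 * N + 1))"
    using E g N by (intro mult_strict_left_mono) (auto simp: algebra_simps g_def)
  also have "\<dots> = E * g\<^sup>2 * (1/8)\<^sup>2" by (simp add: g_def power2_eq_square)
  also have "\<dots> \<le> E * g\<^sup>2 * (norm x0)\<^sup>2"
    using E in0 by (intro mult_left_mono power_mono) auto
  finally show False by simp
qed

section \<open>Sliding paraboloids\<close>

text \<open>The count shared by both Vitali arguments: the \<open>Z i\<close> are enlarged balls
  forming a cover, the \<open>G i\<close> disjoint subsets of the selected balls inside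
  \<open>W\<close>. Finite subfamilies are summed, and the uniform bound passes to the countable
  union.\<close>

lemma measure_UN_le_disjoint:
  fixes Z G :: "'i \<Rightarrow> 'a::euclidean_space set"
  assumes "countable C" and Z: "\<And>i. i \<in> C \<Longrightarrow> Z i \<in> lmeasurable"
    and G: "\<And>i. i \<in> C \<Longrightarrow> G i \<in> lmeasurable" "\<And>i. i \<in> C \<Longrightarrow> G i \<subseteq> W"
    and disj: "pairwise (\<lambda>i j. disjnt (G i) (G j)) C" and W: "W \<in> lmeasurable"
    and le: "\<And>i. i \<in> C \<Longrightarrow> measure lebesgue (Z i) \<le> k * measure lebesgue (G i)" and k: "0 \<le> k"
  shows "(\<Union>i\<in>C. Z i) \<in> lmeasurable" "measure lebesgue (\<Union>i\<in>C. Z i) \<le> k * measure lebesgue W"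
proof -
  have fin: "measure lebesgue (\<Union>i\<in>F. Z i) \<le> k * measure lebesgue W" if F: "F \<subseteq> C" "finite F" for F
  proof -
    have "measure lebesgue (\<Union>i\<in>F. Z i) \<le> (\<Sum>i\<in>F. measure lebesgue (Z i))"
      using F Z by (intro measure_UNION_le) (auto dest: fmeasurableD)
    also have "\<dots> \<le> (\<Sum>i\<in>F. k * measure lebesgue (G i))"
      using F le by (intro sum_mono) auto
    also have "\<dots> = k * measure lebesgue (\<Union>i\<in>F. G i)"
    proof -
      have "measure lebesgue (\<Union>i\<in>F. G i) = (\<Sum>i\<in>F. measure lebesgue (G i))"
      proof (rule measure_finite_Union)
        show "G ` F \<subseteq> sets lebesgue" using F G(1) by (blast dest: fmeasurableD)
        show "disjoint_family_on G F"
          using disj F by (auto simp: disjoint_family_on_def disjnt_def pairwise_def)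
        show "emeasure lebesgue (G i) \<noteq> \<infinity>" if "i \<in> F" for i
          using fmeasurableD2[OF G(1)] F that by (auto simp: infinity_ennreal_def)
      qed (use F in simp)
      then show ?thesis by (simp add: sum_distrib_left)
    qed
    also have "\<dots> \<le> k * measure lebesgue W"
      using F G W k by (intro mult_left_mono measure_mono_fmeasurable) (auto intro!: sets.finite_UN dest: fmeasurableD)
    finally show ?thesis .
  qed
  show "(\<Union>i\<in>C. Z i) \<in> lmeasurable" "measure lebesgue (\<Union>i\<in>C. Z i) \<le> k * measure lebesgue W"
    using fmeasurable_UN_bound[OF \<open>countable C\<close> Z fin] measure_UN_bound[OF \<open>countable C\<close> Z fin] by auto
qed

lemma lebesgue_outer_open:
  fixes S :: "'a::euclidean_space set"
  assumes S: "S \<in> lmeasurable" and "0 < d"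
  obtains U where "open U" "S \<subseteq> U" "U \<in> lmeasurable" "measure lebesgue U < measure lebesgue S + d"
proof -
  obtain U where U: "open U" "S \<subseteq> U" "U - S \<in> lmeasurable" "emeasure lebesgue (U - S) < ennreal d"
    using sets_lebesgue_outer_open[of S d] assms by (metis fmeasurableD)
  have eq: "U = S \<union> (U - S)" using U by auto
  have m: "U \<in> lmeasurable" by (subst eq) (intro fmeasurable.Un S U)
  have "measure lebesgue (U - S) < d"
    using U(4) \<open>0 < d\<close> U(3) by (simp add: emeasure_eq_measure2 ennreal_less_iff)
  then show thesis
    using that[OF U(1,2) m] U S m by (simp add: measurable_measure_Diff fmeasurableD)
qed

text \<open>A relation is used because one vertex may have several contact points. Two points of a
  Vitali ball of radius r enlarged five times are at most 10 r apart, so their vertices are within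
  10 L r; radii at most h0 / 10 keep this in the range of the local Lipschitz bound. Covering
  \<open>Y\<close> directly by the target balls avoids measurability questions about an
  image.\<close>

lemma measure_relation_Lipschitz_le:
  fixes Y S :: "'a::euclidean_space set"
  assumes Y: "Y \<in> lmeasurable" and S: "S \<in> lmeasurable" and L: "0 < L" and h0: "0 < h0"
    and onto: "\<And>y. y \<in> Y \<Longrightarrow> \<exists>x\<in>S. R x y"
    and lip: "\<And>x0 x1 y0 y1 h. \<lbrakk>R x0 y0; R x1 y1; 0 < h; h \<le> h0; norm (x1 - x0) \<le> h\<rbrakk> \<Longrightarrow> norm (y1 - y0) \<le> L * h"
  shows "measure lebesgue Y \<le> (10 * L) ^ DIM('a) * measure lebesgue S"
proof (rule field_le_epsilon)
  let ?c = "(10 * L) ^ DIM('a)"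
  fix d :: real assume "0 < d"
  have c: "0 < ?c" using L by simp
  then have "0 < d / ?c" using \<open>0 < d\<close> by simp
  then obtain U where U: "open U" "S \<subseteq> U" "U \<in> lmeasurable" "measure lebesgue U < measure lebesgue S + d / ?c"
    by (rule lebesgue_outer_open[OF S])
  have "\<exists>r. 0 < r \<and> r \<le> h0 / 10 \<and> ball x r \<subseteq> U" if "x \<in> S" for x
  proof -
    have "x \<in> U" using U(2) that by (rule subsetD)
    then obtain r where r: "0 < r" "ball x r \<subseteq> U" by (rule openE[OF U(1)])
    show ?thesis
      by (rule exI[of _ "min r (h0 / 10)"]) (use r h0 in auto)
  qed
  then obtain r where r: "\<And>x. x \<in> S \<Longrightarrow> 0 < r x \<and> r x \<le> h0 / 10" "\<And>x. x \<in> S \<Longrightarrow> ball x (r x) \<subseteq> U"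
    by metis
  have "S \<subseteq> (\<Union>x\<in>S. ball x (r x))" using r by force
  then obtain C where C: "countable C" "C \<subseteq> S" "pairwise (\<lambda>i j. disjnt (ball i (r i)) (ball j (r j))) C"
     "S \<subseteq> (\<Union>i\<in>C. ball i (5 * r i))"
    by (rule Vitali_covering_lemma_balls[where a = "\<lambda>x. x", OF _ r(1)])
  \<comment> \<open>Any value related to a point of the enlarged ball serves as centre; where there
    is none the choice is arbitrary and \<open>Z i\<close> is a harmless extra member of the
    cover.\<close>
  define y where "y i = (SOME v. \<exists>x\<in>ball i (5 * r i). R x v)" for i
  define Z where "Z i = cball (y i) (10 * L * r i)" for i
  have cov: "Y \<subseteq> (\<Union>i\<in>C. Z i)"
  proof
    fix v assume "v \<in> Y"
    then obtain x where x: "x \<in> S" "R x v" using onto by blast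
    then obtain i where i: "i \<in> C" "x \<in> ball i (5 * r i)" using C by blast
    then have "\<exists>v. \<exists>x\<in>ball i (5 * r i). R x v" using x by blast
    then have "\<exists>x'\<in>ball i (5 * r i). R x' (y i)"
      unfolding y_def by (rule someI_ex)
    then obtain x' where x': "x' \<in> ball i (5 * r i)" "R x' (y i)" by blast
    have ri: "0 < r i" "r i \<le> h0 / 10" using i C r by auto
    have "norm (x' - x) \<le> 10 * r i"
      using i x' dist_triangle_less_add[of x' i "5 * r i" x "5 * r i"] by (simp add: dist_norm norm_minus_commute)
    then have "norm (y i - v) \<le> L * (10 * r i)"
      using ri by (intro lip[OF x(2) x'(2)]) auto
    then have "v \<in> Z i" by (simp add: Z_def dist_norm mult_ac)
    then show "v \<in> (\<Union>i\<in>C. Z i)" using i by blast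
  qed
  have "measure lebesgue (Z i) \<le> ?c * measure lebesgue (ball i (r i))" if "i \<in> C" for i
  proof -
    have "0 < r i" using that C r by auto
    then show ?thesis using L
      by (simp add: Z_def content_ball content_cball power_mult_distrib)
  qed
  note le = this
  have G: "ball i (r i) \<in> lmeasurable" "ball i (r i) \<subseteq> U" "Z i \<in> lmeasurable" if "i \<in> C" for i
    using r(2)[of i] C(2) that by (auto simp: Z_def simp del: mem_ball)
  note UN = measure_UN_le_disjoint[OF C(1) G(3) G(1) G(2) C(3) U(3) le less_imp_le[OF c]]
  have "measure lebesgue Y \<le> measure lebesgue (\<Union>i\<in>C. Z i)"
    using cov Y UN by (intro measure_mono_fmeasurable) auto
  also have "\<dots> \<le> ?c * measure lebesgue U" by (rule UN)
  also have "\<dots> \<le> ?c * (measure lebesgue S + d / ?c)" using U c by (intro mult_left_mono) auto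
  also have "\<dots> = ?c * measure lebesgue S + d" using L by (simp add: field_simps)
  finally show "measure lebesgue Y \<le> ?c * measure lebesgue S + d" .
qed

text \<open>If the vertices \<open>y0\<close>, \<open>y1\<close> were much further apart than the contact points, the maximum of the
  two paraboloids would have a kink on which a strictly convex test function fits. This replaces the
  second order differentiability of the solution at contact points.\<close>

lemma contact_Lipschitz:
  fixes u :: "'a::euclidean_space \<Rightarrow> real"
  assumes N: "1 \<le> N" and sup: "pucci_super N 1 (ball 0 1) u" and cont: "continuous_on (cball 0 1) u"
    and x0: "norm x0 \<le> 1/2" and y0: "norm y0 \<le> 1/8"
    and c0: "\<And>w. norm w \<le> 1 \<Longrightarrow> u x0 + 16 * (norm (x0 - y0))\<^sup>2 \<le> u w + 16 * (norm (w - y0))\<^sup>2"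
    and x1: "norm x1 \<le> 1/2"
    and c1: "\<And>w. norm w \<le> 1 \<Longrightarrow> u x1 + 16 * (norm (x1 - y1))\<^sup>2 \<le> u w + 16 * (norm (w - y1))\<^sup>2"
    and h: "0 < h" "h \<le> 1 / (64 * N)" "norm (x1 - x0) \<le> h"
  shows "norm (y1 - y0) \<le> 16 * N * h"
proof (rule ccontr)
  assume far: "\<not> ?thesis"
  define D where "D = norm (y1 - y0)"
  have D: "16 * N * h < D" using far by (simp add: D_def)
  have Nh: "N * h \<le> 1/64" using h N by (simp add: field_simps)
  have Nh0: "0 < N * h" using h N by simp
  have "0 < D" using D Nh0 by linarith
  define e where "e = (y1 - y0) /\<^sub>R D"
  have e: "norm e = 1" "y1 - y0 = D *\<^sub>R e" using \<open>0 < D\<close> by (auto simp: e_def D_def)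
  \<comment> \<open>Both paraboloids have the same leading coefficient, so they differ by an affine
    function: \<beta> is chosen so that the second one is P + 32 D \<sigma>, and the kink lies on
    the hyperplane \<sigma> = 0.\<close>
  define P where "P x = u x0 + 16 * (norm (x0 - y0))\<^sup>2 - 16 * (norm (x - y0))\<^sup>2" for x
  define \<beta> where "\<beta> = (u x1 + 16 * (norm (x1 - y1))\<^sup>2 - u x0 - 16 * (norm (x0 - y0))\<^sup>2
    + 16 * (norm y0)\<^sup>2 - 16 * (norm y1)\<^sup>2) / (32 * D)"
  define \<sigma> where "\<sigma> x = e \<bullet> x + \<beta>" for x
  have P1: "u x1 + 16 * (norm (x1 - y1))\<^sup>2 - 16 * (norm (x - y1))\<^sup>2 = P x + 32 * D * \<sigma> x" for x
  proof -
    have "32 * D * \<sigma> x = 32 * ((D *\<^sub>R e) \<bullet> x) + 32 * D * \<beta>" by (simp add: \<sigma>_def algebra_simps)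
    also have "32 * D * \<beta> = u x1 + 16 * (norm (x1 - y1))\<^sup>2 - u x0 - 16 * (norm (x0 - y0))\<^sup>2
      + 16 * (norm y0)\<^sup>2 - 16 * (norm y1)\<^sup>2"
      using \<open>0 < D\<close> by (simp add: \<beta>_def)
    finally show ?thesis
      unfolding e(2)[symmetric] P_def power2_norm_eq_inner
      by (simp add: inner_diff_left inner_diff_right inner_commute)
  qed
  have lowP: "P x \<le> u x" "P x + 32 * D * \<sigma> x \<le> u x" if "norm x \<le> 1" for x
    using c0[OF that] c1[OF that] P1[of x] by (simp_all add: P_def)
  have Px0: "P x0 = u x0" by (simp add: P_def)
  \<comment> \<open>At x0 the first paraboloid touches \<open>u\<close> while the second stays
    below, and conversely at x1. Hence \<sigma> changes sign between points at distance at most h,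
    and the kink is close to both.\<close>
  have "32 * D * \<sigma> x0 \<le> 0" using lowP(2)[of x0] x0 Px0 by simp
  then have s0: "\<sigma> x0 \<le> 0" using \<open>0 < D\<close> by (simp add: mult_le_0_iff)
  have "u x1 = P x1 + 32 * D * \<sigma> x1" using P1[of x1] by simp
  moreover have "P x1 \<le> u x1" using lowP x1 by simp
  ultimately have "0 \<le> 32 * D * \<sigma> x1" by linarith
  then have s1: "0 \<le> \<sigma> x1" using \<open>0 < D\<close> by (simp add: zero_le_mult_iff)
  have "\<sigma> x1 - \<sigma> x0 \<le> h"
  proof -
    have "\<sigma> x1 - \<sigma> x0 = e \<bullet> (x1 - x0)" by (simp add: \<sigma>_def inner_diff_right)
    also have "\<dots> \<le> norm e * norm (x1 - x0)" by (rule norm_cauchy_schwarz)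
    finally show ?thesis using e h by simp
  qed
  then have s0': "- h \<le> \<sigma> x0" using s1 by simp
  \<comment> \<open>On the sphere of radius R the quotient |x - x0| / (4 N) is 4 h, the largest
    value of \<sigma> + 2 h in the slab, which makes \<open>q\<close> nonpositive there.\<close>
  define R where "R = 16 * (N * h)"
  have R: "0 < R" "R \<le> 1/4" using Nh Nh0 by (simp_all add: R_def)
  \<comment> \<open>The convex test profile: below max(0, 32 D \<sigma>) on the boundary of
    \<open>K\<close> but positive at x0, where u = P. On the face \<sigma> = 2 h it is at most 1024
    N h^2, less than 64 D h by the assumption that the vertices are far apart; on the opposite face
    it is nonpositive.\<close>
  define q where "q x = 64 * N * ((\<sigma> x + 2 * h)\<^sup>2 - (norm (x - x0) / (4 * N))\<^sup>2)" for x
  define K where "K = cball x0 R \<inter> {x. - 2 * h \<le> \<sigma> x \<and> \<sigma> x \<le> 2 * h}"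
  have K1: "norm x < 1" if "x \<in> K" for x
    using that R x0 norm_triangle_ineq[of x0 "x - x0"] by (auto simp: K_def dist_norm norm_minus_commute)
  have "closed {x. - 2 * h \<le> \<sigma> x \<and> \<sigma> x \<le> 2 * h}"
    unfolding \<sigma>_def by (intro closed_Collect_conj closed_Collect_le continuous_intros)
  then have compK: "compact K" unfolding K_def by (intro compact_Int_closed compact_cball)
  have x0K: "x0 \<in> K" using s0 s0' R h by (simp add: K_def)
  have "continuous_on K (\<lambda>x. u x - P x - q x)"
  proof (intro continuous_intros)
    show "continuous_on K u"
      using K1 by (intro continuous_on_subset[OF cont]) (force simp: less_imp_le)
    show "continuous_on K P" unfolding P_def[abs_def] by (intro continuous_intros)
    show "continuous_on K q" unfolding q_def[abs_def] \<sigma>_def using N by (intro continuous_intros) auto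
  qed
  then obtain x2 where x2: "x2 \<in> K" and min: "\<And>x. x \<in> K \<Longrightarrow> u x2 - P x2 - q x2 \<le> u x - P x - q x"
    using continuous_attains_inf[OF compK] x0K by blast
  have "0 < q x0" using s0' h N by (simp add: q_def)
  then have neg: "u x2 - P x2 < q x2" using min[OF x0K] Px0 by simp
  have lowx2: "0 \<le> u x2 - P x2" "32 * D * \<sigma> x2 \<le> u x2 - P x2"
    using lowP[of x2] K1[OF x2] by simp_all
  have sq: "(\<sigma> x2 + 2 * h)\<^sup>2 \<le> (4 * h)\<^sup>2"
    using x2 h by (intro power_mono) (auto simp: K_def)
  have nle: "\<not> q x2 \<le> 0" using neg lowx2 by linarith
  have "\<sigma> x2 \<noteq> - 2 * h"
    using nle N by (auto simp: q_def)
  moreover have "\<sigma> x2 \<noteq> 2 * h"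
  proof
    assume *: "\<sigma> x2 = 2 * h"
    have "q x2 \<le> 64 * N * ((4 * h)\<^sup>2 - 0)"
      unfolding q_def using N sq by (intro mult_left_mono diff_mono) auto
    also have "\<dots> = 64 * h * (16 * N * h)" by (simp add: power2_eq_square)
    also have "\<dots> \<le> 64 * h * D" using D h by (intro mult_left_mono) auto
    also have "\<dots> = 32 * D * \<sigma> x2" by (simp add: *)
    finally show False using neg lowx2 by linarith
  qed
  moreover have "norm (x2 - x0) \<noteq> R"
  proof
    assume "norm (x2 - x0) = R"
    then have "(norm (x2 - x0) / (4 * N))\<^sup>2 = (4 * h)\<^sup>2" using N by (simp add: R_def)
    then have "q x2 \<le> 0" unfolding q_def using sq N by (intro mult_nonneg_nonpos) auto
    then show False using nle by simp
  qed
  ultimately have in2: "- 2 * h < \<sigma> x2" "\<sigma> x2 < 2 * h" "norm (x2 - x0) < R"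
    using x2 by (auto simp: K_def dist_norm norm_minus_commute)
  define W where "W = {x. - 2 * h < \<sigma> x \<and> \<sigma> x < 2 * h \<and> norm (x - x0) < R}"
  have "open W"
    unfolding W_def \<sigma>_def by (intro open_Collect_conj open_Collect_less continuous_intros)
  moreover have "x2 \<in> W" using in2 by (simp add: W_def)
  ultimately have evW: "\<forall>\<^sub>F x in nhds x2. x \<in> W" by (rule eventually_nhds_in_open)
  \<comment> \<open>The gradient of P + q at x2. Since P + q is quadratic with Hessian 128 N e e^T -
    (32 + 8 / N) I, the polynomial tested next equals it up to a constant.\<close>
  define p where "p = (- 32) *\<^sub>R (x2 - y0) + (128 * N * (\<sigma> x2 + 2 * h)) *\<^sub>R e - (8 / N) *\<^sub>R (x2 - x0)"
  have "\<forall>\<^sub>F x in nhds x2. u x2 + p \<bullet> (x - x2) + (128 * N) / 2 * (e \<bullet> (x - x2))\<^sup>2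
      - (32 + 8 / N) / 2 * (norm (x - x2))\<^sup>2 \<le> u x"
    using evW
  proof eventually_elim
    case (elim x)
    then have "x \<in> K" by (auto simp: K_def W_def dist_norm norm_minus_commute)
    then have "u x2 + (P x - P x2) + (q x - q x2) \<le> u x" using min by fastforce
    moreover have "P x - P x2 = - (32 * ((x2 - y0) \<bullet> (x - x2))) - 16 * (norm (x - x2))\<^sup>2"
      unfolding P_def power2_norm_eq_inner
      by (simp add: inner_diff_left inner_diff_right inner_commute)
    moreover have "q x - q x2 = 128 * N * (\<sigma> x2 + 2 * h) * (e \<bullet> (x - x2)) + 64 * N * (e \<bullet> (x - x2))\<^sup>2
       - (8 / N) * ((x2 - x0) \<bullet> (x - x2)) - (4 / N) * (norm (x - x2))\<^sup>2"
    proof -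
      have 1: "\<sigma> x = \<sigma> x2 + e \<bullet> (x - x2)" by (simp add: \<sigma>_def inner_diff_right)
      have 2: "(norm (x - x0))\<^sup>2 = (norm (x2 - x0))\<^sup>2 + 2 * ((x2 - x0) \<bullet> (x - x2)) + (norm (x - x2))\<^sup>2"
        unfolding power2_norm_eq_inner by (simp add: inner_diff_left inner_diff_right inner_commute)
      show ?thesis
        unfolding q_def power_divide 2 1 using N by (simp add: field_simps power2_eq_square)
    qed
    moreover have "p \<bullet> (x - x2) = - (32 * ((x2 - y0) \<bullet> (x - x2))) + 128 * N * (\<sigma> x2 + 2 * h) * (e \<bullet> (x - x2))
        - 8 / N * ((x2 - x0) \<bullet> (x - x2))"
      unfolding p_def inner_add_left inner_diff_left[of _ "(8 / N) *\<^sub>R (x2 - x0)"] inner_scaleR_left by simp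
    moreover have "(32 + 8 / N) / 2 * (norm (x - x2))\<^sup>2 = 16 * (norm (x - x2))\<^sup>2 + 4 / N * (norm (x - x2))\<^sup>2"
      by (simp add: algebra_simps add_divide_distrib)
    ultimately show ?case by linarith
  qed
  \<comment> \<open>The bound |p| \<le> 42 makes the right-hand side at most 74 N + 9, which is
    below 128 N.\<close>
  from pucci_superD[OF sup _ e(1) _ _ this] have "128 * N \<le> N * (32 + 8 / N + norm p) + 1"
    using K1[OF x2] N by (simp add: add_pos_pos)
  moreover have "norm p \<le> 42"
  proof -
    have "norm (x2 - y0) \<le> 1"
      using norm_triangle_ineq4[of x2 y0] norm_triangle_ineq[of x0 "x2 - x0"] x0 y0 in2 R by simp
    moreover have "128 * N * (\<sigma> x2 + 2 * h) \<le> 128 * N * (4 * h)"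
      using N in2 by (intro mult_left_mono) auto
    moreover have "8 / N * norm (x2 - x0) \<le> 8 * (1/4)"
      using N in2 R by (intro mult_mono) (auto simp: field_simps)
    moreover have "norm p \<le> 32 * norm (x2 - y0) + 128 * N * (\<sigma> x2 + 2 * h) + 8 / N * norm (x2 - x0)"
    proof -
      let ?a = "(- 32) *\<^sub>R (x2 - y0)" and ?b = "(128 * N * (\<sigma> x2 + 2 * h)) *\<^sub>R e" and ?c = "(8 / N) *\<^sub>R (x2 - x0)"
      have "norm p \<le> norm ?a + norm ?b + norm ?c"
        unfolding p_def using norm_triangle_ineq4[of "?a + ?b" ?c] norm_triangle_ineq[of ?a ?b] by linarith
      moreover have "norm ?a = 32 * norm (x2 - y0)" "norm ?c = 8 / N * norm (x2 - x0)" using N by simp_all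
      moreover have "norm ?b = 128 * N * (\<sigma> x2 + 2 * h)" using N in2 e by (simp add: abs_mult)
      ultimately show ?thesis by (simp only:)
    qed
    ultimately show ?thesis using Nh by simp
  qed
  then have "N * (32 + 8 / N + norm p) \<le> N * (32 + 8 / N + 42)" using N by (intro mult_left_mono) auto
  moreover have "N * (32 + 8 / N + 42) = 74 * N + 8" using N by (simp add: field_simps)
  ultimately show False using N by linarith
qed

text \<open>For a vertex y in the ball of radius 1/8, comparison with x1 bounds u + 16 |x - y|^2 at
  the contact point x by 1 + 16 (1/4)^2 = 2. This forces u(x) \<le> 2, and also |x| \<le> 1/2, since
  otherwise the paraboloid alone would contribute 16 (3/8)^2 = 9/4.\<close>

lemma pucci_super_measure:
  fixes u :: "'a::euclidean_space \<Rightarrow> real"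
  assumes N: "1 \<le> N" and sup: "pucci_super N 1 (ball 0 1) u" and cont: "continuous_on (cball 0 1) u"
    and nn: "\<And>x. x \<in> cball 0 1 \<Longrightarrow> 0 \<le> u x" and x1: "norm x1 \<le> 1/8" "u x1 \<le> 1"
  shows "measure lebesgue (cball (0::'a) (1/8)) \<le> (160 * N) ^ DIM('a) * measure lebesgue {x \<in> cball 0 (1/2). u x \<le> 2}"
proof -
  define S where "S = {x \<in> cball 0 (1/2). u x \<le> 2}"
  define R where "R x y \<longleftrightarrow> norm x \<le> 1/2 \<and> norm y \<le> 1/8 \<and>
    (\<forall>w. norm w \<le> 1 \<longrightarrow> u x + 16 * (norm (x - y))\<^sup>2 \<le> u w + 16 * (norm (w - y))\<^sup>2)" for x y
  have "closed (cball 0 (1/2) \<inter> u -` {..2})"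
    by (intro continuous_closed_preimage closed_cball closed_atMost continuous_on_subset[OF cont]) auto
  moreover have "cball 0 (1/2) \<inter> u -` {..2} = S" by (auto simp: S_def)
  ultimately have "closed S" by simp
  moreover have "bounded S" by (rule bounded_subset[OF bounded_cball[of 0 "1/2"]]) (auto simp: S_def)
  ultimately have S: "S \<in> lmeasurable" by (simp add: lmeasurable_compact compact_eq_bounded_closed)
  have "\<exists>x\<in>S. R x y" if "y \<in> cball 0 (1/8)" for y
  proof -
    have y: "norm y \<le> 1/8" using that by simp
    have "continuous_on (cball 0 1) (\<lambda>x. u x + 16 * (norm (x - y))\<^sup>2)"
      by (intro continuous_intros cont)
    then have "\<exists>x\<in>cball 0 1. \<forall>w\<in>cball 0 1. u x + 16 * (norm (x - y))\<^sup>2 \<le> u w + 16 * (norm (w - y))\<^sup>2"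
      by (intro continuous_attains_inf compact_cball) auto
    then obtain x where x: "x \<in> cball 0 1"
      and min: "\<And>w. w \<in> cball 0 1 \<Longrightarrow> u x + 16 * (norm (x - y))\<^sup>2 \<le> u w + 16 * (norm (w - y))\<^sup>2"
      by blast
    have "norm (x1 - y) \<le> 1/4" using norm_triangle_ineq4[of x1 y] x1 y by simp
    then have "(norm (x1 - y))\<^sup>2 \<le> (1/4)\<^sup>2" by (intro power_mono) auto
    then have le2: "u x + 16 * (norm (x - y))\<^sup>2 \<le> 2"
      using min[of x1] x1 by (simp add: power2_eq_square)
    have u0: "0 \<le> u x" using nn x by simp
    have "norm x \<le> 1/2"
    proof (rule ccontr)
      assume "\<not> ?thesis"
      then have "3/8 \<le> norm (x - y)" using norm_triangle_ineq2[of x y] y by simp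
      then have "(3/8)\<^sup>2 \<le> (norm (x - y))\<^sup>2" by (intro power_mono) auto
      then show False using le2 u0 by (simp add: power2_eq_square)
    qed
    moreover have "u x \<le> 2" using le2 zero_le_power2[of "norm (x - y)"] by linarith
    ultimately show ?thesis using y min
      by (intro bexI[of _ x]) (auto simp: S_def R_def)
  qed
  then have "measure lebesgue (cball (0::'a) (1/8)) \<le> (10 * (16 * N)) ^ DIM('a) * measure lebesgue S"
  proof (rule measure_relation_Lipschitz_le[where R = R and ?h0.0 = "1 / (64 * N)", rotated 4])
    fix x0 x1 y0 y1 :: 'a and h :: real
    assume "R x0 y0" "R x1 y1" "0 < h" "h \<le> 1 / (64 * N)" "norm (x1 - x0) \<le> h"
    then show "norm (y1 - y0) \<le> 16 * N * h"
      using contact_Lipschitz[OF N sup cont, of x0 y0 x1 y1 h] by (auto simp: R_def)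
  qed (use N S in auto)
  then show ?thesis by (simp add: S_def)
qed

section \<open>Density estimates\<close>

text \<open>\<open>harnack_const\<close> is twice the barrier height in \<open>pucci_super_doubling\<close>; in \<open>density_const\<close>, the vertices
  fill a ball of radius \<open>1/8\<close> and the contact map expands volumes by at most \<open>(160 N)^n\<close>.\<close>

definition harnack_const :: "real \<Rightarrow> real" where
  "harnack_const N = 4 * exp (9 * (64 * (10 * N + 1)))"

definition density_const :: "real \<Rightarrow> nat \<Rightarrow> real" where
  "density_const N n = (1 / (1280 * N)) ^ n"

lemma harnack_const_gt_1: "1 \<le> N \<Longrightarrow> 1 < harnack_const N"
  using exp_ge_add_one_self[of "9 * (64 * (10 * N + 1))"] by (simp add: harnack_const_def)

lemma pucci_super_mono:
  assumes "pucci_super N c \<Omega> u" "c \<le> c'" "\<Omega>' \<subseteq> \<Omega>"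
  shows "pucci_super N c' \<Omega>' u"
  unfolding pucci_super_def
proof (intro ballI allI impI)
  fix x0 p e s t
  assume "x0 \<in> \<Omega>'" "norm e = 1" "0 < s" "0 < t"
    "\<forall>\<^sub>F x in nhds x0. u x0 + p \<bullet> (x - x0) + s / 2 * (e \<bullet> (x - x0))\<^sup>2 - t / 2 * (norm (x - x0))\<^sup>2 \<le> u x"
  then have "s \<le> N * (t + norm p) + c" using assms by (intro pucci_superD[OF assms(1)]) auto
  then show "s \<le> N * (t + norm p) + c'" using assms by simp
qed

text \<open>The barrier supplies a point of the ball of radius 1/8 where \<open>u\<close> is at most
  A; dividing by A normalises \<open>u\<close> for the sliding argument, whose level 2 becomes 2 A,
  which is \<open>harnack_const N\<close>. The radius ratio (1/8) / (160 N) is the base in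
  \<open>density_const\<close>.\<close>

lemma pucci_super_density_unit:
  fixes u :: "'a::euclidean_space \<Rightarrow> real"
  assumes N: "1 \<le> N" and sup: "pucci_super N 1 (ball 0 4) u"
    and cont: "continuous_on (ball 0 4) u" and nn: "\<And>x. x \<in> ball 0 4 \<Longrightarrow> 0 \<le> u x"
    and y: "y \<in> cball 0 2" "u y \<le> 1"
  shows "density_const N DIM('a) * measure lebesgue (ball (0::'a) 1)
    \<le> measure lebesgue {x \<in> cball 0 (1/2). u x \<le> harnack_const N}"
proof -
  define A where "A = 2 * exp (9 * (64 * (10 * N + 1)))"
  have A: "1 \<le> A" and A2: "harnack_const N = 2 * A"
    using harnack_const_gt_1[OF N] exp_ge_add_one_self[of "9 * (64 * (10 * N + 1))"] N
    by (simp_all add: A_def harnack_const_def)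
  obtain x1 where x1: "norm x1 \<le> 1/8" "u x1 \<le> A"
    using pucci_super_doubling[OF assms] unfolding A_def[symmetric] by auto
  have "pucci_super N (1 * 1\<^sup>2 / A) (ball 0 1) (\<lambda>x. (u (0 + 1 *\<^sub>R x) - 0) / A)"
    using sup A N by (intro pucci_super_scale) auto
  then have "pucci_super N (1 / A) (ball 0 1) (\<lambda>x. u x / A)" by simp
  then have sup': "pucci_super N 1 (ball 0 1) (\<lambda>x. u x / A)"
    using A by (elim pucci_super_mono[of N _ "ball 0 1"]) (auto simp: field_simps)
  have "measure lebesgue (cball (0::'a) (1/8))
    \<le> (160 * N) ^ DIM('a) * measure lebesgue {x \<in> cball 0 (1/2). u x / A \<le> 2}"
  proof (rule pucci_super_measure[OF N sup'])
    show "continuous_on (cball 0 1) (\<lambda>x. u x / A)"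
      using A by (intro continuous_intros continuous_on_subset[OF cont]) auto
  qed (use A nn x1 in auto)
  also have "{x \<in> cball 0 (1/2). u x / A \<le> 2} = {x \<in> cball 0 (1/2). u x \<le> harnack_const N}"
    using A by (auto simp: field_simps A2)
  finally have "measure lebesgue (cball (0::'a) (1/8)) / (160 * N) ^ DIM('a)
      \<le> measure lebesgue {x \<in> cball 0 (1/2). u x \<le> harnack_const N}"
    using N by (simp add: field_simps)
  moreover have "measure lebesgue (cball (0::'a) (1/8)) / (160 * N) ^ DIM('a)
      = density_const N DIM('a) * measure lebesgue (ball (0::'a) 1)"
  proof -
    have "density_const N DIM('a) = ((1/8) / (160 * N)) ^ DIM('a)" by (simp add: density_const_def)
    also have "\<dots> = (1/8) ^ DIM('a) / (160 * N) ^ DIM('a)" by (rule power_divide)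
    finally show ?thesis by (simp add: content_ball content_cball)
  qed
  ultimately show ?thesis by simp
qed

section \<open>Density of sublevel sets across scales\<close>

lemma open_superlevel:
  fixes u :: "'a::euclidean_space \<Rightarrow> real"
  assumes "continuous_on S u" "open T" "T \<subseteq> S"
  shows "open {x \<in> T. a < u x}" 
proof -
  have "open (T \<inter> u -` {a<..})"
    using assms by (intro continuous_open_preimage continuous_on_subset[OF assms(1)]) auto
  moreover have "T \<inter> u -` {a<..} = {x \<in> T. a < u x}" by auto
  ultimately show ?thesis by simp
qed

lemma lmeasurable_level_sets:
  fixes u :: "'a::euclidean_space \<Rightarrow> real"
  assumes "continuous_on S u" "ball z r \<subseteq> S"
  shows "{x \<in> ball z r. u x \<le> a} \<in> lmeasurable" "{x \<in> ball z r. a < u x} \<in> lmeasurable"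
proof -
  have "open {x \<in> ball z r. a < u x}" using open_superlevel[OF assms(1) open_ball assms(2)] .
  then show 1: "{x \<in> ball z r. a < u x} \<in> lmeasurable"
    by (intro lmeasurable_open bounded_subset[OF bounded_ball[of z r]]) auto
  have "{x \<in> ball z r. u x \<le> a} = ball z r - {x \<in> ball z r. a < u x}" by auto
  then show "{x \<in> ball z r. u x \<le> a} \<in> lmeasurable"
    using 1 by (simp add: fmeasurable.Diff)
qed

text \<open>Rescaling turns the inhomogeneity 1 into r^2 / m, which stays at most 1 because r \<le>
  1 \<le> m. The closed half ball of the unit estimate is mapped into the open ball of radius
  r.\<close>

lemma pucci_super_density:
  fixes u :: "'a::euclidean_space \<Rightarrow> real"
  assumes N: "1 \<le> N" and r: "0 < r" "r \<le> 1" and m: "1 \<le> m" and sup: "pucci_super N 1 (ball z (4 * r)) u"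
    and cont: "continuous_on (ball z (4 * r)) u" and nn: "\<And>x. x \<in> ball z (4 * r) \<Longrightarrow> 0 \<le> u x"
    and y: "y \<in> cball z (2 * r)" "u y \<le> m"
  shows "density_const N DIM('a) * measure lebesgue (ball z r)
    \<le> measure lebesgue {x \<in> ball z r. u x \<le> harnack_const N * m}"
proof -
  define v where "v x = (u (z + r *\<^sub>R x) - 0) / m" for x
  have maps: "z + r *\<^sub>R x \<in> ball z (k * r) \<longleftrightarrow> x \<in> ball 0 k" for x k
    using r by (simp add: dist_norm)
  have "pucci_super N (1 * r\<^sup>2 / m) (ball 0 4) v"
    unfolding v_def[abs_def] using r m N maps by (intro pucci_super_scale[OF sup]) auto
  moreover have "1 * r\<^sup>2 / m \<le> 1"
    using r m power_le_one[of r 2] by simp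
  ultimately have sup': "pucci_super N 1 (ball 0 4) v"
    by (rule pucci_super_mono) simp
  have cont': "continuous_on (ball 0 4) v"
    unfolding v_def[abs_def] using m maps[of _ 4]
    by (intro continuous_intros continuous_on_compose2[OF cont]) auto
  define y' where "y' = (1 / r) *\<^sub>R (y - z)"
  have y': "z + r *\<^sub>R y' = y" using r by (simp add: y'_def)
  have "norm y' = norm (y - z) / r" using r by (simp add: y'_def)
  then have "y' \<in> cball 0 2" using y r by (simp add: dist_norm norm_minus_commute pos_divide_le_eq mult.commute)
  moreover have "v y' \<le> 1" using y m by (simp add: v_def y')
  ultimately have d: "density_const N DIM('a) * measure lebesgue (ball (0::'a) 1)
      \<le> measure lebesgue {x \<in> cball 0 (1/2). v x \<le> harnack_const N}"
    using nn maps m by (intro pucci_super_density_unit[OF N sup' cont']) (auto simp: v_def)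
  have sub: "(\<lambda>x. r *\<^sub>R x + z) ` {x \<in> cball 0 (1/2). v x \<le> harnack_const N} \<subseteq> {x \<in> ball z r. u x \<le> harnack_const N * m}"
  proof (rule image_subsetI)
    fix x assume x: "x \<in> {x \<in> cball 0 (1/2). v x \<le> harnack_const N}"
    then have "z + r *\<^sub>R x \<in> ball z (1 * r)" unfolding maps by simp
    then show "r *\<^sub>R x + z \<in> {x \<in> ball z r. u x \<le> harnack_const N * m}"
      using x m by (simp add: v_def field_simps add.commute)
  qed
  have meas: "{x \<in> ball z r. u x \<le> harnack_const N * m} \<in> lmeasurable"
    using r by (intro lmeasurable_level_sets[OF cont] subset_ball) auto
  have "closed (cball 0 (1/2) \<inter> v -` {..harnack_const N})"
    by (intro continuous_closed_preimage closed_cball closed_atMost continuous_on_subset[OF cont']) auto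
  then have "compact (cball 0 (1/2) \<inter> v -` {..harnack_const N})"
    by (metis compact_Int_closed compact_cball inf.idem inf_assoc)
  then have "compact ((\<lambda>x. r *\<^sub>R x + z) ` (cball 0 (1/2) \<inter> v -` {..harnack_const N}))"
    by (intro compact_continuous_image continuous_intros)
  moreover have "cball 0 (1/2) \<inter> v -` {..harnack_const N} = {x \<in> cball 0 (1/2). v x \<le> harnack_const N}" by auto
  ultimately have im: "(\<lambda>x. r *\<^sub>R x + z) ` {x \<in> cball 0 (1/2). v x \<le> harnack_const N} \<in> sets lebesgue"
    by (simp add: lmeasurable_compact fmeasurableD)
  have "density_const N DIM('a) * measure lebesgue (ball z r)
      = r ^ DIM('a) * (density_const N DIM('a) * measure lebesgue (ball (0::'a) 1))"
    using r by (simp add: content_ball)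
  also have "\<dots> \<le> r ^ DIM('a) * measure lebesgue {x \<in> cball 0 (1/2). v x \<le> harnack_const N}"
    using d r by (intro mult_left_mono) auto
  also have "\<dots> = measure lebesgue ((\<lambda>x. r *\<^sub>R x + z) ` {x \<in> cball 0 (1/2). v x \<le> harnack_const N})"
    using r by (simp add: measure_lebesgue_affine)
  also have "\<dots> \<le> measure lebesgue {x \<in> ball z r. u x \<le> harnack_const N * m}"
    by (rule measure_mono_fmeasurable[OF sub im meas])
  finally show ?thesis .
qed

lemma density_const_pos: "1 \<le> N \<Longrightarrow> 0 < density_const N n"
  by (simp add: density_const_def)

text \<open>Positive density makes a sublevel set nonempty, and a point of the ball of radius 2^-i
  lies in the closed ball of twice the next radius, so it starts the next scale with one more factor
  \<open>harnack_const N\<close>. Radius 5 leaves room for balls of radius 4 centred in the unit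
  ball.\<close>

lemma pucci_super_chain:
  fixes u :: "'a::euclidean_space \<Rightarrow> real"
  assumes N: "1 \<le> N" and sup: "pucci_super N 1 (ball 0 5) u"
    and cont: "continuous_on (ball 0 5) u" and nn: "\<And>x. x \<in> ball 0 5 \<Longrightarrow> 0 \<le> u x"
    and y: "y \<in> cball 0 1" "u y \<le> 1" and x: "x \<in> ball 0 1"
  shows "density_const N DIM('a) * measure lebesgue (ball x ((1/2) ^ j))
      \<le> measure lebesgue {y \<in> ball x ((1/2) ^ j). u y \<le> harnack_const N ^ Suc j}"
proof -
  note M = harnack_const_gt_1[OF N]
  have step: "density_const N DIM('a) * measure lebesgue (ball x ((1/2) ^ i))
      \<le> measure lebesgue {y \<in> ball x ((1/2) ^ i). u y \<le> harnack_const N ^ Suc i}"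
    if near: "\<exists>y\<in>cball x (2 * (1/2) ^ i). u y \<le> harnack_const N ^ i" for i
  proof -
    have r: "(1/2 :: real) ^ i \<le> 1" by (rule power_le_one) auto
    have sub: "ball x (4 * (1/2) ^ i) \<subseteq> ball 0 5"
      using x r by (simp add: ball_subset_ball_iff)
    from near obtain z where z: "z \<in> cball x (2 * (1/2) ^ i)" "u z \<le> harnack_const N ^ i" by blast
    have "1 \<le> harnack_const N ^ i" using M by (intro one_le_power) auto
    moreover have "pucci_super N 1 (ball x (4 * (1/2) ^ i)) u"
      by (rule pucci_super_mono[OF sup order_refl sub])
    moreover have "continuous_on (ball x (4 * (1/2) ^ i)) u"
      by (rule continuous_on_subset[OF cont sub])
    ultimately have "density_const N DIM('a) * measure lebesgue (ball x ((1/2) ^ i))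
      \<le> measure lebesgue {y \<in> ball x ((1/2) ^ i). u y \<le> harnack_const N * harnack_const N ^ i}"
      using r nn sub z by (intro pucci_super_density[OF N, where y = z]) auto
    then show ?thesis by simp
  qed
  have "\<exists>y\<in>cball x (2 * (1/2) ^ i). u y \<le> harnack_const N ^ i" for i
  proof (induction i)
    case 0
    have "dist x y \<le> 2" using x y norm_triangle_ineq4[of x y] by (simp add: dist_norm)
    then show ?case using y by auto
  next
    case (Suc i)
    have "0 < density_const N DIM('a) * measure lebesgue (ball x ((1/2) ^ i))"
      using density_const_pos[OF N] by (intro mult_pos_pos) auto
    then have "measure lebesgue {y \<in> ball x ((1/2) ^ i). u y \<le> harnack_const N ^ Suc i} \<noteq> 0"
      using step[OF Suc] by linarith
    then have "{y \<in> ball x ((1/2) ^ i). u y \<le> harnack_const N ^ Suc i} \<noteq> {}"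
      by (metis measure_empty)
    then obtain z where "z \<in> ball x ((1/2) ^ i)" "u z \<le> harnack_const N ^ Suc i" by blast
    then show ?case by (intro bexI[of _ z]) auto
  qed
  then show ?thesis by (rule step)
qed

text \<open>Around every point of the superlevel set \<open>{M m < u}\<close> the last dyadic ball in which \<open>{u \<le> M m}\<close>
  still has density at least \<open>density_const\<close> is contained in \<open>{m < u}\<close>.\<close>

lemma superlevel_growth:
  fixes u :: "'a::euclidean_space \<Rightarrow> real"
  assumes N: "1 \<le> N" and sup: "pucci_super N 1 (ball 0 5) u"
    and cont: "continuous_on (ball 0 5) u" and nn: "\<And>x. x \<in> ball 0 5 \<Longrightarrow> 0 \<le> u x"
    and m: "1 \<le> m" and d: "0 < d" "\<rho> + d \<le> 1"
    and dens: "\<And>x. x \<in> ball 0 1 \<Longrightarrow> density_const N DIM('a) * measure lebesgue (ball x d)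
      \<le> measure lebesgue {y \<in> ball x d. u y \<le> harnack_const N * m}"
  shows "(1 + density_const N DIM('a) / 5 ^ DIM('a)) * measure lebesgue {x \<in> ball 0 \<rho>. harnack_const N * m < u x}
    \<le> measure lebesgue {x \<in> ball 0 (\<rho> + d). m < u x}"
proof -
  let ?\<mu> = "density_const N DIM('a)" and ?a = "harnack_const N * m"
  define E where "E = {x \<in> ball 0 \<rho>. ?a < u x}"
  define F where "F = {x \<in> ball 0 (\<rho> + d). m < u x}"
  have sub5: "ball (0::'a) s \<subseteq> ball 0 5" if "s \<le> 1" for s using that by (intro subset_ball) auto
  have EF: "E \<in> lmeasurable" "F \<in> lmeasurable"
    unfolding E_def F_def by (rule lmeasurable_level_sets(2)[OF cont sub5], use d in linarith)+
  have ma: "m \<le> ?a" using harnack_const_gt_1[OF N] m by simp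
  have "E \<subseteq> F" using ma d by (auto simp: E_def F_def)
  have \<mu>: "0 < ?\<mu>" by (rule density_const_pos[OF N])
  have "\<exists>r. 0 < r \<and> r \<le> d \<and> ball x r \<subseteq> F \<and> ?\<mu> * measure lebesgue (ball x r) \<le> measure lebesgue {y \<in> ball x r. u y \<le> ?a}"
    if "x \<in> E" for x
  proof -
    \<comment> \<open>The density condition at radius d / 2^i: true for i = 0 by
      \<open>dens\<close>, false once the ball lies in the open superlevel set around x, so some
      success is directly followed by a failure.\<close>
    define Q where "Q i \<longleftrightarrow> ?\<mu> * measure lebesgue (ball x (d / 2 ^ i)) \<le> measure lebesgue {y \<in> ball x (d / 2 ^ i). u y \<le> ?a}" for i :: nat
    have xn: "norm x < \<rho>" "norm x < 1" "?a < u x" using that d by (auto simp: E_def)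
    have "open {x \<in> ball 0 1. ?a < u x}" by (rule open_superlevel[OF cont open_ball sub5]) simp
    then obtain \<epsilon> where \<epsilon>: "0 < \<epsilon>" "ball x \<epsilon> \<subseteq> {x \<in> ball 0 1. ?a < u x}"
      by (rule openE[where x = x]) (use xn in auto)
    obtain i where i: "d / \<epsilon> < 2 ^ i" using real_arch_pow[of 2 "d / \<epsilon>"] by auto
    then have "d / 2 ^ i < \<epsilon>" using \<epsilon> by (simp add: field_simps)
    then have "ball x (d / 2 ^ i) \<subseteq> ball x \<epsilon>" by (intro subset_ball) auto
    then have "{y \<in> ball x (d / 2 ^ i). u y \<le> ?a} = {}" using \<epsilon>(2) by force
    moreover have "0 < ?\<mu> * measure lebesgue (ball x (d / 2 ^ i))" using \<mu> d by (intro mult_pos_pos) auto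
    ultimately have "\<not> Q i" unfolding Q_def by (simp only: measure_empty not_le)
    moreover have "Q 0" using dens[of x] xn by (simp add: Q_def)
    ultimately obtain k where k: "Q k" "\<not> Q (Suc k)"
      by (metis nat_induct)
    define r where "r = d / 2 ^ k"
    have r: "0 < r" "r \<le> d" "d / 2 ^ Suc k = r / 2" using d by (auto simp: r_def field_simps)
    have r1: "norm x + r < \<rho> + d" using r xn by simp
    have "norm x + d < 1" using xn d by simp
    have rr: "r \<le> 1" using r1 d norm_ge_zero[of x] by linarith
    have s5: "ball x (4 * (r / 2)) \<subseteq> ball 0 5"
      using rr xn by (simp add: ball_subset_ball_iff)
    \<comment> \<open>A point with u \<le> m in the closed ball of radius r, which is twice r / 2,
      would give the density condition at radius r / 2, against the failure at
      \<open>Suc k\<close>.\<close>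
    have up: "m < u y" if "y \<in> cball x r" for y
    proof (rule ccontr)
      assume "\<not> m < u y"
      then have "?\<mu> * measure lebesgue (ball x (r / 2)) \<le> measure lebesgue {y \<in> ball x (r / 2). u y \<le> ?a}"
        using that r rr nn s5
        by (intro pucci_super_density[OF N _ _ m, where y = y] pucci_super_mono[OF sup _ s5] continuous_on_subset[OF cont s5]) auto
      then show False using k(2) unfolding Q_def r(3) by simp
    qed
    have "ball x r \<subseteq> F"
    proof
      fix y assume "y \<in> ball x r"
      moreover have "norm y \<le> norm x + dist x y" using norm_triangle_ineq[of x "y - x"] by (simp add: dist_norm norm_minus_commute)
      ultimately show "y \<in> F" using up[of y] r1 by (simp add: F_def)
    qed
    then show ?thesis using r k(1) unfolding Q_def r_def[symmetric] by blast
  qed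
  then have "\<forall>x\<in>E. \<exists>r. 0 < r \<and> r \<le> d \<and> ball x r \<subseteq> F \<and>
      ?\<mu> * measure lebesgue (ball x r) \<le> measure lebesgue {y \<in> ball x r. u y \<le> ?a}" ..
  from bchoice[OF this] obtain r where "\<forall>x\<in>E. 0 < r x \<and> r x \<le> d \<and> ball x (r x) \<subseteq> F \<and>
      ?\<mu> * measure lebesgue (ball x (r x)) \<le> measure lebesgue {y \<in> ball x (r x). u y \<le> ?a}" ..
  then have r: "\<And>x. x \<in> E \<Longrightarrow> 0 < r x \<and> r x \<le> d" "\<And>x. x \<in> E \<Longrightarrow> ball x (r x) \<subseteq> F"
    "\<And>x. x \<in> E \<Longrightarrow> ?\<mu> * measure lebesgue (ball x (r x)) \<le> measure lebesgue {y \<in> ball x (r x). u y \<le> ?a}"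
    by blast+
  have "E \<subseteq> (\<Union>x\<in>E. ball x (r x))" using r(1) by force
  then obtain C where C: "countable C" "C \<subseteq> E" "pairwise (\<lambda>i j. disjnt (ball i (r i)) (ball j (r j))) C"
     "E \<subseteq> (\<Union>i\<in>C. ball i (5 * r i))"
    by (rule Vitali_covering_lemma_balls[where a = "\<lambda>x. x", OF _ r(1)])
  \<comment> \<open>These low parts lie in F - E and are disjoint, and each carries at least the
    fraction density_const / 5^n of its enlarged ball; thus |E| is controlled by |F| - |E|.\<close>
  define G where "G i = {y \<in> ball i (r i). u y \<le> ?a}" for i
  define Z where "Z i = ball i (5 * r i)" for i
  have CE: "i \<in> E" if "i \<in> C" for i using that C(2) by blast
  have Fs: "F \<subseteq> ball 0 5" using d by (auto simp: F_def)
  have le: "measure lebesgue (Z i) \<le> (5 ^ DIM('a) / ?\<mu>) * measure lebesgue (G i)" if "i \<in> C" for i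
  proof -
    have "0 < r i" using r(1) CE that by blast
    then have "measure lebesgue (Z i) = 5 ^ DIM('a) / ?\<mu> * (?\<mu> * measure lebesgue (ball i (r i)))"
      using \<mu> by (simp add: Z_def content_ball power_mult_distrib)
    also have "\<dots> \<le> 5 ^ DIM('a) / ?\<mu> * measure lebesgue (G i)"
      using r(3)[OF CE[OF that]] \<mu> by (intro mult_left_mono) (auto simp: G_def)
    finally show ?thesis .
  qed
  have Zm: "Z i \<in> lmeasurable" for i by (simp add: Z_def)
  have Gm: "G i \<in> lmeasurable" if "i \<in> C" for i
    unfolding G_def using r(2)[OF CE[OF that]] Fs by (intro lmeasurable_level_sets[OF cont]) auto
  have Gs: "G i \<subseteq> F - E" if "i \<in> C" for i
    using r(2)[OF CE[OF that]] by (auto simp: G_def E_def)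
  have Gd: "pairwise (\<lambda>i j. disjnt (G i) (G j)) C"
    using C(3) by (auto simp: pairwise_def disjnt_iff G_def)
  have FE: "F - E \<in> lmeasurable" using EF by (simp add: fmeasurable.Diff)
  have k0: "0 \<le> 5 ^ DIM('a) / ?\<mu>" using \<mu> by simp
  note UN = measure_UN_le_disjoint[OF C(1) Zm Gm Gs Gd FE le k0]
  have "measure lebesgue E \<le> measure lebesgue (\<Union>i\<in>C. Z i)"
    using C(4) EF UN(1) by (intro measure_mono_fmeasurable) (auto simp: Z_def fmeasurableD)
  also have "\<dots> \<le> 5 ^ DIM('a) / ?\<mu> * measure lebesgue (F - E)" by (rule UN(2))
  also have "measure lebesgue (F - E) = measure lebesgue F - measure lebesgue E"
    using EF \<open>E \<subseteq> F\<close> by (simp add: measurable_measure_Diff fmeasurableD)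
  finally show ?thesis
    using \<mu> by (simp add: field_simps E_def F_def)
qed

text \<open>Each growth step raises the level by a factor \<open>harnack_const N\<close>, shrinks
  the radius by d and gains a factor \<eta> > 1. From radius 1 to 1/2 the total gain must exceed
  2^(n + 1): 2^n for the volume ratio and 2 for the half.\<close>

lemma pucci_super_superlevel_small:
  assumes N: "1 \<le> N"
  obtains M where "1 < M"
    "\<And>u :: 'a::euclidean_space \<Rightarrow> real. \<And>y. pucci_super N 1 (ball 0 5) u \<Longrightarrow> continuous_on (ball 0 5) u \<Longrightarrow>
      (\<And>x. x \<in> ball 0 5 \<Longrightarrow> 0 \<le> u x) \<Longrightarrow> y \<in> cball 0 1 \<Longrightarrow> u y \<le> 1 \<Longrightarrow>
      measure lebesgue {x \<in> ball 0 (1/2). M < u x} < 1/2 * measure lebesgue (ball (0::'a) (1/2))"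
proof -
  let ?M = "harnack_const N" and ?n = "DIM('a)"
  define \<eta> where "\<eta> = 1 + density_const N ?n / 5 ^ ?n"
  have \<eta>: "1 < \<eta>" using density_const_pos[OF N] by (simp add: \<eta>_def)
  obtain i where i: "2 ^ Suc ?n < \<eta> ^ i" using real_arch_pow[OF \<eta>] by blast
  \<comment> \<open>The step number and size are tied by K d = 1/2, and d has to be a power of 1/2
    for \<open>pucci_super_chain\<close>. The choice K = 2^i satisfies both, and i \<le> K preserves
    the required gain.\<close>
  define K where "K = (2::nat) ^ i"
  have "i \<le> K" unfolding K_def by (simp add: less_imp_le)
  then have "\<eta> ^ i \<le> \<eta> ^ K" using \<eta> by (intro power_increasing) auto
  then have K: "2 ^ Suc ?n < \<eta> ^ K" using i by linarith
  define j where "j = Suc i"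
  define d where "d = (1/2::real) ^ j"
  have dK: "K * d = 1/2" by (simp add: K_def d_def j_def power_one_over)
  have d0: "0 < d" by (simp add: d_def)
  note M1 = harnack_const_gt_1[OF N]
  have M: "1 \<le> ?M ^ k" for k using M1 by (intro one_le_power) auto
  show ?thesis
  proof (rule that[of "?M ^ (Suc j + K)"])
    show "1 < ?M ^ (Suc j + K)" using M1 by (intro one_less_power) auto
    fix u :: "'a \<Rightarrow> real" and y
    assume sup: "pucci_super N 1 (ball 0 5) u" and cont: "continuous_on (ball 0 5) u"
      and nn: "\<And>x. x \<in> ball 0 5 \<Longrightarrow> 0 \<le> u x" and y: "y \<in> cball 0 1" "u y \<le> 1"
    \<comment> \<open>The level exponent starts at \<open>Suc j\<close>, the one that the chain
      reaches at radius d = 2^-j; the density it gives persists at all higher levels.\<close>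
    define e where "e k = measure lebesgue {x \<in> ball 0 (1 - k * d). ?M ^ (Suc j + k) < u x}" for k :: nat
    have chain: "density_const N ?n * measure lebesgue (ball x d) \<le> measure lebesgue {z \<in> ball x d. u z \<le> ?M * ?M ^ (Suc j + k)}"
      if "x \<in> ball 0 1" for x k
    proof -
      have "d \<le> 1" unfolding d_def by (intro power_le_one) auto
      then have b: "ball x d \<subseteq> ball 0 5" using that by (simp add: ball_subset_ball_iff)
      have "density_const N ?n * measure lebesgue (ball x d) \<le> measure lebesgue {z \<in> ball x d. u z \<le> ?M ^ Suc j}"
        unfolding d_def by (rule pucci_super_chain[OF N sup cont nn y that])
      also have "\<dots> \<le> measure lebesgue {z \<in> ball x d. u z \<le> ?M * ?M ^ (Suc j + k)}"
      proof (rule measure_mono_fmeasurable)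
        have "?M ^ Suc j \<le> ?M ^ (Suc (Suc j + k))" using M1 by (intro power_increasing) auto
        then show "{z \<in> ball x d. u z \<le> ?M ^ Suc j} \<subseteq> {z \<in> ball x d. u z \<le> ?M * ?M ^ (Suc j + k)}" by auto
      qed (use lmeasurable_level_sets[OF cont b] in \<open>auto simp: fmeasurableD\<close>)
      finally show ?thesis .
    qed
    have step: "\<eta> * e (Suc k) \<le> e k" for k
    proof -
      have eq: "1 - Suc k * d + d = 1 - k * d" by (simp add: algebra_simps)
      have "(1 + density_const N ?n / 5 ^ ?n) * measure lebesgue {x \<in> ball 0 (1 - Suc k * d). ?M * ?M ^ (Suc j + k) < u x}
        \<le> measure lebesgue {x \<in> ball 0 (1 - Suc k * d + d). ?M ^ (Suc j + k) < u x}"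
        using d0 by (intro superlevel_growth[OF N sup cont nn M d0 _ chain]) (auto simp: algebra_simps)
      from this[unfolded eq] show ?thesis by (simp add: e_def \<eta>_def)
    qed
    have "\<eta> ^ k * e k \<le> e 0" for k
    proof (induction k)
      case (Suc k)
      have "\<eta> ^ Suc k * e (Suc k) = \<eta> ^ k * (\<eta> * e (Suc k))" by simp
      also have "\<dots> \<le> \<eta> ^ k * e k" using step \<eta> by (intro mult_left_mono) auto
      finally show ?case using Suc by simp
    qed simp
    then have "\<eta> ^ K * e K \<le> e 0" .
    also have "e 0 \<le> measure lebesgue (ball (0::'a) 1)"
    proof -
      have "ball (0::'a) 1 \<subseteq> ball 0 5" by (intro subset_ball) simp
      note lm = fmeasurableD[OF lmeasurable_level_sets(2)[OF cont this]]
      have "e 0 = measure lebesgue {x \<in> ball 0 1. ?M ^ Suc j < u x}" by (simp add: e_def)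
      also have "\<dots> \<le> measure lebesgue (ball (0::'a) 1)"
        by (rule measure_mono_fmeasurable[OF _ lm]) auto
      finally show ?thesis .
    qed
    also have "\<dots> = 2 ^ ?n * measure lebesgue (ball (0::'a) (1/2))"
      by (simp add: content_ball power_one_over)
    also have "\<dots> < \<eta> ^ K * (1/2 * measure lebesgue (ball (0::'a) (1/2)))"
    proof -
      have "2 ^ Suc ?n * (1/2 * measure lebesgue (ball (0::'a) (1/2))) < \<eta> ^ K * (1/2 * measure lebesgue (ball (0::'a) (1/2)))"
        using K by (intro mult_strict_right_mono) auto
      then show ?thesis by simp
    qed
    finally have "e K < 1/2 * measure lebesgue (ball (0::'a) (1/2))"
      using \<eta> by (simp add: mult_less_cancel_left_pos)
    then show "measure lebesgue {x \<in> ball 0 (1/2). ?M ^ (Suc j + K) < u x} < 1/2 * measure lebesgue (ball (0::'a) (1/2))"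
      by (simp add: e_def dK)
  qed
qed

section \<open>Oscillation decay and the Hoelder estimate\<close>

text \<open>If both alternatives fail, v and 1 - v are each small somewhere, so v > 1/4 and v < 3/4
  each hold on less than half of the ball of radius 1/2, although together these sets cover
  it.\<close>

lemma pucci_super_oscillation_unit:
  assumes N: "1 \<le> N"
  obtains \<theta> where "0 < \<theta>" "\<theta> < 1"
    "\<And>v :: 'a::euclidean_space \<Rightarrow> real. pucci_super N \<theta> (ball 0 5) v \<Longrightarrow> pucci_super N \<theta> (ball 0 5) (\<lambda>x. 1 - v x) \<Longrightarrow>
      continuous_on (ball 0 5) v \<Longrightarrow> (\<And>x. x \<in> ball 0 5 \<Longrightarrow> 0 \<le> v x \<and> v x \<le> 1) \<Longrightarrow>
      (\<forall>x\<in>cball 0 1. \<theta> \<le> v x) \<or> (\<forall>x\<in>cball 0 1. v x \<le> 1 - \<theta>)"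
proof -
  obtain M where M: "1 < M"
    and small: "\<And>u :: 'a \<Rightarrow> real. \<And>y. pucci_super N 1 (ball 0 5) u \<Longrightarrow> continuous_on (ball 0 5) u \<Longrightarrow>
      (\<And>x. x \<in> ball 0 5 \<Longrightarrow> 0 \<le> u x) \<Longrightarrow> y \<in> cball 0 1 \<Longrightarrow> u y \<le> 1 \<Longrightarrow>
      measure lebesgue {x \<in> ball 0 (1/2). M < u x} < 1/2 * measure lebesgue (ball (0::'a) (1/2))"
    using pucci_super_superlevel_small[OF N] by blast
  \<comment> \<open>Level M of v / \<theta> becomes level 1/4 of v, and division by \<theta> turns
    the inhomogeneity \<theta> into 1.\<close>
  define \<theta> where "\<theta> = 1 / (4 * M)"
  have \<theta>: "0 < \<theta>" "\<theta> < 1" using M by (auto simp: \<theta>_def)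
  have quarter: "measure lebesgue {x \<in> ball 0 (1/2). 1/4 < v x} < 1/2 * measure lebesgue (ball (0::'a) (1/2))"
    if sup: "pucci_super N \<theta> (ball 0 5) v" and cont: "continuous_on (ball 0 5) v"
      and nn: "\<And>x. x \<in> ball 0 5 \<Longrightarrow> 0 \<le> v x" and y: "y \<in> cball 0 1" "v y < \<theta>" for v :: "'a \<Rightarrow> real" and y
  proof -
    have "pucci_super N (\<theta> * 1\<^sup>2 / \<theta>) (ball 0 5) (\<lambda>x. (v (0 + 1 *\<^sub>R x) - 0) / \<theta>)"
      using \<theta> N by (intro pucci_super_scale[OF sup]) auto
    then have "pucci_super N 1 (ball 0 5) (\<lambda>x. v x / \<theta>)" using \<theta> by simp
    then have "measure lebesgue {x \<in> ball 0 (1/2). M < v x / \<theta>} < 1/2 * measure lebesgue (ball (0::'a) (1/2))"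
      using \<theta> nn y by (intro small[where y = y] continuous_intros cont) auto
    moreover have "M < a / \<theta> \<longleftrightarrow> 1/4 < a" for a using M by (simp add: \<theta>_def field_simps)
    ultimately show ?thesis by simp
  qed
  show ?thesis
  proof (rule that[OF \<theta>])
    fix v :: "'a \<Rightarrow> real"
    assume sup: "pucci_super N \<theta> (ball 0 5) v" "pucci_super N \<theta> (ball 0 5) (\<lambda>x. 1 - v x)"
      and cont: "continuous_on (ball 0 5) v" and bd: "\<And>x. x \<in> ball 0 5 \<Longrightarrow> 0 \<le> v x \<and> v x \<le> 1"
    show "(\<forall>x\<in>cball 0 1. \<theta> \<le> v x) \<or> (\<forall>x\<in>cball 0 1. v x \<le> 1 - \<theta>)"
    proof (rule ccontr)
      assume "\<not> ?thesis"
      then obtain y z where y: "y \<in> cball 0 1" "v y < \<theta>" and z: "z \<in> cball 0 1" "1 - v z < \<theta>"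
        by (auto simp: not_le)
      have cont': "continuous_on (ball 0 5) (\<lambda>x. 1 - v x)" by (intro continuous_intros cont)
      let ?A = "{x \<in> ball 0 (1/2). 1/4 < v x}" and ?B = "{x \<in> ball 0 (1/2). 1/4 < 1 - v x}"
      have sub: "ball (0::'a) (1/2) \<subseteq> ball 0 5" by (intro subset_ball) simp
      have m: "?A \<in> lmeasurable" "?B \<in> lmeasurable"
        by (rule lmeasurable_level_sets(2)[OF cont sub] lmeasurable_level_sets(2)[OF cont' sub])+
      have "ball 0 (1/2) = ?A \<union> ?B" by auto
      then have "measure lebesgue (ball (0::'a) (1/2)) = measure lebesgue (?A \<union> ?B)" by (rule arg_cong)
      also have "\<dots> \<le> measure lebesgue ?A + measure lebesgue ?B"
        by (rule measure_Un_le[OF fmeasurableD[OF m(1)] fmeasurableD[OF m(2)]])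
      finally have "measure lebesgue (ball (0::'a) (1/2)) \<le> measure lebesgue ?A + measure lebesgue ?B" .
      moreover have "measure lebesgue ?A < 1/2 * measure lebesgue (ball (0::'a) (1/2))"
        by (rule quarter[OF sup(1) cont _ y]) (use bd in blast)
      moreover have "measure lebesgue ?B < 1/2 * measure lebesgue (ball (0::'a) (1/2))"
        by (rule quarter[OF sup(2) cont' _ z]) (use bd in force)
      ultimately show False by linarith
    qed
  qed
qed

text \<open>Normalising values to [0, 1] changes the inhomogeneity to c r^2 / \<omega>, which the
  smallness assumption keeps below \<theta>. Shifting - u by -(k + \<omega>) makes its rescaling
  exactly 1 - v.\<close>

lemma pucci_super_oscillation:
  assumes N: "1 \<le> N"
  obtains \<theta> where "0 < \<theta>" "\<theta> < 1"
    "\<And>(u :: 'a::euclidean_space \<Rightarrow> real) z r c \<omega> k. pucci_super N c (ball z (r * 5)) u \<Longrightarrow>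
      pucci_super N c (ball z (r * 5)) (\<lambda>x. - u x) \<Longrightarrow> continuous_on (ball z (r * 5)) u \<Longrightarrow> 0 < r \<Longrightarrow> r \<le> 1 \<Longrightarrow> 0 < \<omega> \<Longrightarrow>
      c * r\<^sup>2 \<le> \<theta> * \<omega> \<Longrightarrow> (\<And>x. x \<in> ball z (r * 5) \<Longrightarrow> k \<le> u x \<and> u x \<le> k + \<omega>) \<Longrightarrow>
      \<exists>k'. \<forall>x\<in>ball z r. k' \<le> u x \<and> u x \<le> k' + (1 - \<theta>) * \<omega>"
proof -
  obtain \<theta> where \<theta>: "0 < \<theta>" "\<theta> < 1"
    and osc: "\<And>v :: 'a \<Rightarrow> real. pucci_super N \<theta> (ball 0 5) v \<Longrightarrow> pucci_super N \<theta> (ball 0 5) (\<lambda>x. 1 - v x) \<Longrightarrow>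
      continuous_on (ball 0 5) v \<Longrightarrow> (\<And>x. x \<in> ball 0 5 \<Longrightarrow> 0 \<le> v x \<and> v x \<le> 1) \<Longrightarrow>
      (\<forall>x\<in>cball 0 1. \<theta> \<le> v x) \<or> (\<forall>x\<in>cball 0 1. v x \<le> 1 - \<theta>)"
    using pucci_super_oscillation_unit[OF N, where 'a = 'a] by blast
  show ?thesis
  proof (rule that[OF \<theta>])
    fix u :: "'a \<Rightarrow> real" and z r c \<omega> k
    assume sup: "pucci_super N c (ball z (r * 5)) u" "pucci_super N c (ball z (r * 5)) (\<lambda>x. - u x)"
      and cont: "continuous_on (ball z (r * 5)) u" and r: "0 < r" "r \<le> 1" and \<omega>: "0 < \<omega>"
      and small: "c * r\<^sup>2 \<le> \<theta> * \<omega>" and bd: "\<And>x. x \<in> ball z (r * 5) \<Longrightarrow> k \<le> u x \<and> u x \<le> k + \<omega>"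
    define v where "v x = (u (z + r *\<^sub>R x) - k) / \<omega>" for x
    have maps: "z + r *\<^sub>R x \<in> ball z (r * s) \<longleftrightarrow> x \<in> ball 0 s" for x s
      using r by (simp add: dist_norm)
    have c: "c * r\<^sup>2 / \<omega> \<le> \<theta>" using small \<omega> by (simp add: field_simps)
    have "pucci_super N (c * r\<^sup>2 / \<omega>) (ball 0 5) v"
      unfolding v_def[abs_def] using r \<omega> N maps by (intro pucci_super_scale[OF sup(1)]) auto
    then have s1: "pucci_super N \<theta> (ball 0 5) v" by (rule pucci_super_mono[OF _ c order_refl])
    have "pucci_super N (c * r\<^sup>2 / \<omega>) (ball 0 5) (\<lambda>x. (- u (z + r *\<^sub>R x) - (- (k + \<omega>))) / \<omega>)"
      using r \<omega> N maps by (intro pucci_super_scale[OF sup(2)]) auto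
    moreover have "(\<lambda>x. (- u (z + r *\<^sub>R x) - (- (k + \<omega>))) / \<omega>) = (\<lambda>x. 1 - v x)"
      using \<omega> by (auto simp: v_def fun_eq_iff field_simps)
    ultimately have s2: "pucci_super N \<theta> (ball 0 5) (\<lambda>x. 1 - v x)"
      using pucci_super_mono[OF _ c order_refl] by simp
    have cv: "continuous_on (ball 0 5) v"
      unfolding v_def[abs_def] using \<omega> maps[of _ 5]
      by (intro continuous_intros continuous_on_compose2[OF cont]) auto
    have bv: "0 \<le> v x \<and> v x \<le> 1" if "x \<in> ball 0 5" for x
      using bd[of "z + r *\<^sub>R x"] that maps[of x 5] \<omega> by (simp add: v_def field_simps)
    have pull: "\<exists>y\<in>cball 0 1. v y = (u x - k) / \<omega>" if "x \<in> ball z r" for x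
    proof
      show "v ((1 / r) *\<^sub>R (x - z)) = (u x - k) / \<omega>" using r by (simp add: v_def)
      have "norm ((1 / r) *\<^sub>R (x - z)) = norm (x - z) / r" using r by simp
      then show "(1 / r) *\<^sub>R (x - z) \<in> cball 0 1"
        using that r by (simp add: dist_norm norm_minus_commute pos_divide_le_eq)
    qed
    have bdr: "k \<le> u x \<and> u x \<le> k + \<omega>" if "x \<in> ball z r" for x
      using bd[of x] that r by simp
    from osc[OF s1 s2 cv bv] show "\<exists>k'. \<forall>x\<in>ball z r. k' \<le> u x \<and> u x \<le> k' + (1 - \<theta>) * \<omega>"
    proof
      assume low: "\<forall>x\<in>cball 0 1. \<theta> \<le> v x"
      show ?thesis
      proof (intro exI[of _ "k + \<theta> * \<omega>"] ballI)
        fix x assume x: "x \<in> ball z r"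
        then have "\<theta> \<le> (u x - k) / \<omega>" using pull low by metis
        then show "k + \<theta> * \<omega> \<le> u x \<and> u x \<le> k + \<theta> * \<omega> + (1 - \<theta>) * \<omega>"
          using \<omega> bdr[OF x] by (simp add: field_simps)
      qed
    next
      assume up: "\<forall>x\<in>cball 0 1. v x \<le> 1 - \<theta>"
      show ?thesis
      proof (intro exI[of _ k] ballI)
        fix x assume x: "x \<in> ball z r"
        then have "(u x - k) / \<omega> \<le> 1 - \<theta>" using pull up by metis
        then show "k \<le> u x \<and> u x \<le> k + (1 - \<theta>) * \<omega>"
          using \<omega> bdr[OF x] by (simp add: field_simps)
      qed
    qed
  qed
qed

lemma pucci_super_Holder:
  assumes N: "1 \<le> N"
  obtains \<alpha> \<theta> where "0 < \<alpha>" "\<alpha> < 1" "0 < \<theta>"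
    "\<And>(u :: 'a::euclidean_space \<Rightarrow> real) c C0 x y. pucci_super N c (ball 0 1) u \<Longrightarrow> pucci_super N c (ball 0 1) (\<lambda>x. - u x) \<Longrightarrow>
      continuous_on (ball 0 1) u \<Longrightarrow> 0 < c \<Longrightarrow> 0 < C0 \<Longrightarrow> (\<And>x. x \<in> ball 0 1 \<Longrightarrow> \<bar>u x\<bar> \<le> C0) \<Longrightarrow>
      x \<in> ball 0 (1/2) \<Longrightarrow> y \<in> ball 0 (1/2) \<Longrightarrow> \<bar>u x - u y\<bar> \<le> 10 * (2 * C0 + c / \<theta>) * norm (x - y) powr \<alpha>"
proof -
  obtain \<theta> where \<theta>: "0 < \<theta>" "\<theta> < 1"
    and osc: "\<And>(u :: 'a \<Rightarrow> real) z r c \<omega> k. pucci_super N c (ball z (r * 5)) u \<Longrightarrow>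
      pucci_super N c (ball z (r * 5)) (\<lambda>x. - u x) \<Longrightarrow> continuous_on (ball z (r * 5)) u \<Longrightarrow> 0 < r \<Longrightarrow> r \<le> 1 \<Longrightarrow> 0 < \<omega> \<Longrightarrow>
      c * r\<^sup>2 \<le> \<theta> * \<omega> \<Longrightarrow> (\<And>x. x \<in> ball z (r * 5) \<Longrightarrow> k \<le> u x \<and> u x \<le> k + \<omega>) \<Longrightarrow>
      \<exists>k'. \<forall>x\<in>ball z r. k' \<le> u x \<and> u x \<le> k' + (1 - \<theta>) * \<omega>"
    using pucci_super_oscillation[OF N, where 'a = 'a] by blast
  \<comment> \<open>The lower bound 1/2 keeps q^k above 5^-k, which dominates r^2, so the smallness
    condition survives every iteration; as 1/2 > 1/5 it also gives \<alpha> < 1.\<close>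
  define q where "q = max (1 - \<theta>) (1/2)"
  have q: "1 - \<theta> \<le> q" "1/2 \<le> q" "q < 1" using \<theta> by (auto simp: q_def)
  define \<alpha> where "\<alpha> = - log 5 q"
  have q\<alpha>: "q = 5 powr (- \<alpha>)" using q by (simp add: \<alpha>_def)
  have "log 5 q < 0" using q by (simp add: log_less_zero_cancel_iff)
  moreover have "log 5 (1/5) < log 5 q" using q by (subst log_less_cancel_iff) auto
  ultimately have \<alpha>: "0 < \<alpha>" "\<alpha> < 1" by (auto simp: \<alpha>_def log_divide)
  show ?thesis
  proof (rule that[OF \<alpha> \<theta>(1)])
    fix u :: "'a \<Rightarrow> real" and c C0 :: real and x y :: 'a
    assume sup: "pucci_super N c (ball 0 1) u" "pucci_super N c (ball 0 1) (\<lambda>x. - u x)"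
      and cont: "continuous_on (ball 0 1) u" and c: "0 < c" and C0: "0 < C0"
      and bd: "\<And>x. x \<in> ball 0 1 \<Longrightarrow> \<bar>u x\<bar> \<le> C0"
      and x: "x \<in> ball 0 (1/2)" and y: "y \<in> ball 0 (1/2)"
    \<comment> \<open>The first summand bounds the initial oscillation, the second ensures c \<le>
      \<theta> C1, the smallness condition at the first scale.\<close>
    define C1 where "C1 = 2 * C0 + c / \<theta>"
    have "0 < c / \<theta>" using c \<theta> by simp
    then have C1: "2 * C0 \<le> C1" "c / \<theta> \<le> C1" "0 < C1" using C0 by (auto simp: C1_def)
    have c\<theta>: "c \<le> \<theta> * C1" using C1(2) \<theta> by (simp add: field_simps)
    have iter: "\<exists>a. \<forall>w\<in>ball x ((1/5) ^ k / 2). a \<le> u w \<and> u w \<le> a + C1 * q ^ k" for k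
    proof (induction k)
      case 0
      show ?case
      proof (intro exI[of _ "- C0"] ballI)
        fix w assume "w \<in> ball x ((1/5) ^ 0 / 2)"
        then have "w \<in> ball 0 1"
          using x norm_triangle_ineq[of x "w - x"] by (simp add: dist_norm norm_minus_commute)
        then show "- C0 \<le> u w \<and> u w \<le> - C0 + C1 * q ^ 0" using bd[of w] C1 by (auto simp: abs_le_iff)
      qed
    next
      case (Suc k)
      then obtain a where a: "\<forall>w\<in>ball x ((1/5) ^ k / 2). a \<le> u w \<and> u w \<le> a + C1 * q ^ k" by blast
      define r where "r = (1/5 :: real) ^ Suc k / 2"
      have r5: "r * 5 = (1/5) ^ k / 2" by (simp add: r_def)
      have k1: "(1/5 :: real) ^ k \<le> 1" by (rule power_le_one) auto
      have r: "0 < r" "r \<le> 1" using k1 by (auto simp: r_def)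
      have sub: "ball x (r * 5) \<subseteq> ball 0 1"
        unfolding r5 using x k1 by (simp add: ball_subset_ball_iff)
      have "r\<^sup>2 \<le> r * 1" unfolding power2_eq_square using r by (intro mult_left_mono) auto
      also have "r \<le> (1/5) ^ k" by (simp add: r_def)
      also have "(1/5) ^ k \<le> q ^ k" using q by (intro power_mono) auto
      finally have rq: "r\<^sup>2 \<le> q ^ k" by simp
      have "c * r\<^sup>2 \<le> (\<theta> * C1) * q ^ k" using c\<theta> rq c by (intro mult_mono) auto
      then have "c * r\<^sup>2 \<le> \<theta> * (C1 * q ^ k)" by (simp add: mult.assoc)
      moreover have "0 < C1 * q ^ k" using C1 q by simp
      ultimately obtain a' where a': "\<forall>w\<in>ball x r. a' \<le> u w \<and> u w \<le> a' + (1 - \<theta>) * (C1 * q ^ k)"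
        using osc[OF pucci_super_mono[OF sup(1) order_refl sub] pucci_super_mono[OF sup(2) order_refl sub]
            continuous_on_subset[OF cont sub] r, of "C1 * q ^ k" a] a unfolding r5 by blast
      have "(1 - \<theta>) * (C1 * q ^ k) \<le> q * (C1 * q ^ k)" using q C1 by (intro mult_right_mono) auto
      then have "(1 - \<theta>) * (C1 * q ^ k) \<le> C1 * q ^ Suc k" by (simp add: mult_ac)
      then show ?case using a' unfolding r_def by (intro exI[of _ a']) force
    qed
    define \<delta> where "\<delta> = norm (x - y)"
    have "\<bar>u x - u y\<bar> \<le> 10 * C1 * \<delta> powr \<alpha>"
    proof (cases "\<delta> = 0")
      case True
      then show ?thesis by (simp add: \<delta>_def)
    next
      case False
      then have \<delta>: "0 < \<delta>" by (simp add: \<delta>_def)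
      show ?thesis
      proof (cases "\<delta> < 1/2")
        case True
        obtain i where "(1/5) ^ i < \<delta> * 2" using real_arch_pow_inv[of "\<delta> * 2" "1/5"] \<delta> by auto
        then have "\<not> \<delta> < (1/5) ^ i / 2" by simp
        \<comment> \<open>The scale matching the distance: the failure at \<open>Suc k\<close> gives
          5^-k \<le> 10 \<delta>, the origin of the factor 10 in the estimate.\<close>
        then obtain k where k: "\<delta> < (1/5) ^ k / 2" "\<not> \<delta> < (1/5) ^ Suc k / 2"
          using nat_induct[of "\<lambda>k. \<delta> < (1/5) ^ k / 2" i] True by auto
        obtain a where a: "\<forall>w\<in>ball x ((1/5) ^ k / 2). a \<le> u w \<and> u w \<le> a + C1 * q ^ k" using iter by blast
        have "x \<in> ball x ((1/5) ^ k / 2)" "y \<in> ball x ((1/5) ^ k / 2)" using k by (auto simp: \<delta>_def dist_norm)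
        then have "a \<le> u x \<and> u x \<le> a + C1 * q ^ k" "a \<le> u y \<and> u y \<le> a + C1 * q ^ k" using a by blast+
        then have "\<bar>u x - u y\<bar> \<le> C1 * q ^ k" by (auto simp: abs_le_iff)
        also have "q ^ k = ((1/5) ^ k) powr \<alpha>"
        proof -
          have "q ^ k = 5 powr (- \<alpha> * k)" unfolding q\<alpha> by (simp add: powr_powr powr_realpow[symmetric] mult.commute)
          also have "\<dots> = (5 powr (- real k)) powr \<alpha>" by (simp add: powr_powr mult.commute)
          also have "5 powr (- real k) = (1/5 :: real) ^ k" by (simp add: powr_minus powr_realpow power_one_over inverse_eq_divide)
          finally show ?thesis .
        qed
        also have "((1/5) ^ k) powr \<alpha> \<le> (10 * \<delta>) powr \<alpha>" using k \<alpha> by (intro powr_mono2) auto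
        also have "(10 * \<delta>) powr \<alpha> = 10 powr \<alpha> * \<delta> powr \<alpha>" using \<delta> by (simp add: powr_mult)
        also have "10 powr \<alpha> * \<delta> powr \<alpha> \<le> 10 powr 1 * \<delta> powr \<alpha>" using \<alpha> by (intro mult_right_mono powr_mono) auto
        finally show ?thesis using C1 by (simp add: mult_left_mono mult_ac)
      next
        case False
        have "\<bar>u x - u y\<bar> \<le> C1" using bd[of x] bd[of y] x y C1 by auto
        moreover have "(1/2) powr 1 \<le> (1/2 :: real) powr \<alpha>" using \<alpha> by (intro powr_mono') auto
        moreover have "(1/2) powr \<alpha> \<le> \<delta> powr \<alpha>" using False \<alpha> by (intro powr_mono2) auto
        ultimately have "1/2 \<le> \<delta> powr \<alpha>" by simp
        then have "10 * C1 * (1/2) \<le> 10 * C1 * \<delta> powr \<alpha>" using C1 by (intro mult_left_mono) auto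
        then show ?thesis using \<open>\<bar>u x - u y\<bar> \<le> C1\<close> C1 by linarith
      qed
    qed
    then show "\<bar>u x - u y\<bar> \<le> 10 * (2 * C0 + c / \<theta>) * norm (x - y) powr \<alpha>"
      by (simp add: C1_def \<delta>_def)
  qed
qed

text \<open>The set where |u| exceeds b is open by continuity and null by the essential bound, hence
  empty.\<close>

lemma Linf_norm_bound:
  fixes u :: "real^'n \<Rightarrow> real"
  assumes cont: "continuous_on S u" and S: "open S" and le: "Linf_norm S u \<le> ennreal b" and b: "0 \<le> b"
    and x: "x \<in> S"
  shows "\<bar>u x\<bar> \<le> b"
proof (rule ccontr)
  assume big: "\<not> ?thesis"
  define U where "U = S \<inter> (\<lambda>x. \<bar>u x\<bar>) -` {b<..}"
  have "open U"
    unfolding U_def by (intro continuous_open_preimage continuous_intros cont S)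
  have "AE x in restrict_space lborel S. ennreal \<bar>u x\<bar> \<le> Linf_norm S u"
    unfolding Linf_norm_def by (rule esssup_AE)
  then have "AE x in lborel. x \<in> S \<longrightarrow> ennreal \<bar>u x\<bar> \<le> Linf_norm S u"
    using S by (subst (asm) AE_restrict_space_iff) auto
  then have "AE x in lborel. x \<notin> U"
  proof eventually_elim
    case (elim x)
    have "\<bar>u x\<bar> \<le> b" if "x \<in> S"
      using order.trans[OF elim[rule_format, OF that] le] b by simp
    then show ?case by (auto simp: U_def)
  qed
  then have "U \<in> null_sets lborel"
    using \<open>open U\<close> by (subst (asm) AE_iff_null_sets[symmetric]) auto
  then have "negligible U"
    using negligible_iff_null_sets null_sets_completionI by blast
  moreover have "x \<in> U" using x big by (simp add: U_def)
  ultimately show False using open_not_negligible[OF \<open>open U\<close>] by blast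
qed

theorem theorem1p1:
  shows "\<forall>lam Lam. lam > 0 \<longrightarrow> Lam > 0 \<longrightarrow>
    (\<exists>\<alpha>. 0 < \<alpha> \<and> \<alpha> < 1 \<and>
      (\<forall>\<rho>>0. \<exists>C>0. \<forall>kappa C0. kappa > 0 \<longrightarrow> C0 > 0 \<longrightarrow> kappa / C0 = \<rho> \<longrightarrow>
        (\<forall>u :: real^'n \<Rightarrow> real.
          continuous_on (cball 0 1) u \<longrightarrow>
          viscosity_le (L_minus lam Lam kappa) (ball 0 1) C0 u \<longrightarrow>
          viscosity_ge (L_plus lam Lam kappa) (ball 0 1) (- C0) u \<longrightarrow>
          Linf_norm (ball 0 1) u \<le> ennreal C0 \<longrightarrow>
          u \<in> holder_space \<alpha> (ball 0 (1/2)) \<and>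
          holder_norm \<alpha> (ball 0 (1/2)) u \<le> ennreal (C * C0))))"
proof (intro allI impI)
  fix lam Lam :: real
  assume pos: "0 < lam" "0 < Lam"
  \<comment> \<open>Only \<open>lam\<close>, \<open>Lam\<close> and the dimension enter, so \<alpha>
    and \<theta> are fixed before \<open>kappa\<close> and \<open>C0\<close> appear.\<close>
  define N where "N = 1 + Lam * CARD('n) / lam"
  have N: "1 \<le> N" using pos by (simp add: N_def)
  obtain \<alpha> \<theta> where \<alpha>: "0 < \<alpha>" "\<alpha> < 1" and \<theta>: "0 < \<theta>"
    and holder: "\<And>(u :: real^'n \<Rightarrow> real) c C0 x y. pucci_super N c (ball 0 1) u \<Longrightarrow> pucci_super N c (ball 0 1) (\<lambda>x. - u x) \<Longrightarrow>
      continuous_on (ball 0 1) u \<Longrightarrow> 0 < c \<Longrightarrow> 0 < C0 \<Longrightarrow> (\<And>x. x \<in> ball 0 1 \<Longrightarrow> \<bar>u x\<bar> \<le> C0) \<Longrightarrow>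
      x \<in> ball 0 (1/2) \<Longrightarrow> y \<in> ball 0 (1/2) \<Longrightarrow> \<bar>u x - u y\<bar> \<le> 10 * (2 * C0 + c / \<theta>) * norm (x - y) powr \<alpha>"
    using pucci_super_Holder[OF N, where 'a = "real^'n"] by blast
  show "\<exists>\<alpha>. 0 < \<alpha> \<and> \<alpha> < 1 \<and>
      (\<forall>\<rho>>0. \<exists>C>0. \<forall>kappa C0. kappa > 0 \<longrightarrow> C0 > 0 \<longrightarrow> kappa / C0 = \<rho> \<longrightarrow>
        (\<forall>u :: real^'n \<Rightarrow> real.
          continuous_on (cball 0 1) u \<longrightarrow>
          viscosity_le (L_minus lam Lam kappa) (ball 0 1) C0 u \<longrightarrow>
          viscosity_ge (L_plus lam Lam kappa) (ball 0 1) (- C0) u \<longrightarrow>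
          Linf_norm (ball 0 1) u \<le> ennreal C0 \<longrightarrow>
          u \<in> holder_space \<alpha> (ball 0 (1/2)) \<and>
          holder_norm \<alpha> (ball 0 (1/2)) u \<le> ennreal (C * C0)))"
  proof (rule exI[of _ \<alpha>], intro conjI \<alpha> allI impI)
    fix \<rho> :: real assume \<rho>: "0 < \<rho>"
    \<comment> \<open>With kappa = \<rho> C0, the quotient of C0 / lam + kappa by \<theta> is b C0.
      In \<open>C\<close> the summand 1 pays for the sup norm and 10 (2 + b) for the
      seminorm.\<close>
    define b where "b = (1 / lam + \<rho>) / \<theta>"
    define C where "C = 1 + 10 * (2 + b)"
    have "0 < b" unfolding b_def using pos \<rho> \<theta> by (auto intro!: divide_pos_pos add_pos_pos)
    then have C: "0 < C" by (simp add: C_def)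
    show "\<exists>C>0. \<forall>kappa C0. kappa > 0 \<longrightarrow> C0 > 0 \<longrightarrow> kappa / C0 = \<rho> \<longrightarrow>
        (\<forall>u :: real^'n \<Rightarrow> real.
          continuous_on (cball 0 1) u \<longrightarrow>
          viscosity_le (L_minus lam Lam kappa) (ball 0 1) C0 u \<longrightarrow>
          viscosity_ge (L_plus lam Lam kappa) (ball 0 1) (- C0) u \<longrightarrow>
          Linf_norm (ball 0 1) u \<le> ennreal C0 \<longrightarrow>
          u \<in> holder_space \<alpha> (ball 0 (1/2)) \<and>
          holder_norm \<alpha> (ball 0 (1/2)) u \<le> ennreal (C * C0))"
    proof (rule exI[of _ C], intro conjI C allI impI)
      fix kappa C0 :: real and u :: "real^'n \<Rightarrow> real"
      assume k: "0 < kappa" "0 < C0" "kappa / C0 = \<rho>"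
        and cont: "continuous_on (cball 0 1) u"
        and v: "viscosity_le (L_minus lam Lam kappa) (ball 0 1) C0 u"
          "viscosity_ge (L_plus lam Lam kappa) (ball 0 1) (- C0) u"
        and Li: "Linf_norm (ball 0 1) u \<le> ennreal C0"
      have cont': "continuous_on (ball 0 1) u" by (rule continuous_on_subset[OF cont]) auto
      have bd: "\<bar>u x\<bar> \<le> C0" if "x \<in> ball 0 1" for x
        using Linf_norm_bound[OF cont' open_ball Li _ that] k by simp
      note sup = viscosity_le_pucci_super[OF pos k(1,2) v(1), folded N_def]
        viscosity_ge_pucci_super[OF pos k(1,2) v(2), folded N_def]
      define c where "c = C0 / lam + kappa"
      have c: "0 < c" using pos k by (auto simp: c_def intro!: add_pos_pos)
      define H where "H = 10 * (2 * C0 + c / \<theta>)"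
      have "0 < c / \<theta>" using c \<theta> by simp
      then have H: "0 < H" using k by (simp add: H_def)
      have "kappa = \<rho> * C0" using k by (simp add: field_simps)
      then have CH: "C * C0 = C0 + H" using pos \<theta> by (simp add: C_def b_def H_def c_def field_simps)
      have "holder_seminorm \<alpha> (ball 0 (1/2)) u \<le> ennreal H"
        unfolding holder_seminorm_def
      proof (rule SUP_least, clarify)
        fix x y :: "real^'n" assume xy: "x \<in> ball 0 (1/2)" "y \<in> ball 0 (1/2)" "x \<noteq> y"
        have "\<bar>u x - u y\<bar> \<le> H * norm (x - y) powr \<alpha>"
          unfolding H_def by (rule holder[OF sup[folded c_def] cont' c k(2) bd xy(1,2)])
        then have "\<bar>u x - u y\<bar> / norm (x - y) powr \<alpha> \<le> H" using xy by (simp add: pos_divide_le_eq)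
        then show "ennreal (\<bar>u x - u y\<bar> / norm (x - y) powr \<alpha>) \<le> ennreal H" by (rule ennreal_leI)
      qed
      moreover have "(SUP x\<in>ball 0 (1/2). ennreal \<bar>u x\<bar>) \<le> ennreal C0"
        by (intro SUP_least ennreal_leI bd) auto
      ultimately have "holder_norm \<alpha> (ball 0 (1/2)) u \<le> ennreal C0 + ennreal H"
        unfolding holder_norm_def by (intro add_mono)
      also have "\<dots> = ennreal (C * C0)" using k H by (simp add: CH ennreal_plus)
      finally show "holder_norm \<alpha> (ball 0 (1/2)) u \<le> ennreal (C * C0)" .
      then show "u \<in> holder_space \<alpha> (ball 0 (1/2))"
        unfolding holder_space_def by (auto simp: order.strict_trans1)
    qed
  qed
qed

end
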